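(* Let $T>1$. If $f\in C^\alpha([-1,1])$, where $\alpha>\frac12$, then $$\|f-f_N\|_{L^\infty(-1,1)}\to0\quad\text{as }N\to\infty.$$
   Context: Fix $T>1$. For each odd positive integer $N=2n+1$ let $\mathcal{H}_N=\mathrm{span}\{e^{\frac{i\pi}{T}kx}\}_{k=-n}^{n}$, regarded as a space of functions on $[-1,1]$. For $f\in L^2(-1,1)$, the Fourier extension $f_N\in\mathcal{H}_N$ is the unique minimizer of $\|f-r\|_{L^2(-1,1)}$ over $r\in\mathcal{H}_N$, i.e. the $L^2(-1,1)$-orthogonal projection of $f$ onto $\mathcal{H}_N$. The limit $N\to\infty$ is through odd integers. For $\alpha\in[0,1]$, $C^\alpha([-1,1])$ is the Hölder space of $f\in C([-1,1])$ with $\sup_{x\ne y\in[-1,1]}\frac{|f(x)-f(y)|}{|x-y|^\alpha}<\infty$. *)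

theory Defs
  imports "HOL-Analysis.Analysis" "HOL-Probability.Essential_Supremum"
begin

text \<open>
  Functions on \<open>[-1,1]\<close> are complex-valued functions on the reals of which only the
  values on \<open>[-1,1]\<close> matter.
\<close>

definition holder_space :: "real \<Rightarrow> (real \<Rightarrow> complex) set" where
  "holder_space \<alpha> =
     {f. continuous_on {-1..1} f \<and>
         bdd_above {cmod (f x - f y) / \<bar>x - y\<bar> powr \<alpha> |x y.
                      x \<in> {-1..1} \<and> y \<in> {-1..1} \<and> x \<noteq> y}}"

text \<open>
  The complex span of the functions \<open>exp (i \<pi> k x / T)\<close>, \<open>k = -n..n\<close>, for odd \<open>N = 2 n + 1\<close>,
  so that \<open>n = N div 2\<close>. The elements are restricted to \<open>[-1,1]\<close> (and thus take the fixed
  value \<open>undefined\<close> elsewhere), so that two of them are equal iff they agree on \<open>[-1,1]\<close>.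
\<close>

definition fourier_space :: "real \<Rightarrow> nat \<Rightarrow> (real \<Rightarrow> complex) set" where
  "fourier_space T N =
     {restrict (\<lambda>x. \<Sum>k = - int (N div 2)..int (N div 2).
                      c k * exp (\<i> * complex_of_real (pi / T * of_int k * x))) {-1..1} |c.
        c \<in> (UNIV :: (int \<Rightarrow> complex) set)}"

text \<open>
  The value is meaningful only for square-integrable \<open>g\<close>; the Bochner integral of a
  non-integrable function is 0.
\<close>

definition L2_norm :: "(real \<Rightarrow> complex) \<Rightarrow> real" where
  "L2_norm g = sqrt (LINT x|lebesgue_on {-1<..<1}. (cmod (g x))\<^sup>2)"

definition Linf_norm :: "(real \<Rightarrow> complex) \<Rightarrow> ereal" where
  "Linf_norm g = esssup (lebesgue_on {-1<..<1}) (\<lambda>x. ereal (cmod (g x)))"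

definition fourier_extension :: "real \<Rightarrow> nat \<Rightarrow> (real \<Rightarrow> complex) \<Rightarrow> real \<Rightarrow> complex" where
  "fourier_extension T N f =
     (THE r. r \<in> fourier_space T N \<and>
             (\<forall>s\<in>fourier_space T N. L2_norm (\<lambda>x. f x - r x) \<le> L2_norm (\<lambda>x. f x - s x)))"

end

theory Submission
  imports Defs "HOL-Real_Asymp.Real_Asymp"
begin

text \<open>
  Since \<open>f\<close> has Hoelder exponent above 1/2, it can be approximated from \<open>H\<^sub>N\<close> with uniform
  error \<open>O(N\<^sup>-\<^sup>\<alpha>)\<close>, so it is enough that the projection enlarge the supremum of a continuous
  function at most by a factor \<open>O(N\<^sup>1\<^sup>/\<^sup>2)\<close>, up to a logarithm. Such a bound is proved for polynomial
  projections, to which the Fourier extension is reduced.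

  Separate \<open>f\<close> into real and imaginary, even and odd parts, and put
  \<open>u = sin (\<pi>x / 2T) / sin (\<pi> / 2T)\<close>, a smooth change of variable of \<open>[-1,1]\<close> because \<open>T > 1\<close>.
  With \<open>\<kappa>(u) = cos (\<pi>x / 2T)\<close>, the even functions in \<open>H\<^sub>N\<close> are the even polynomials in \<open>u\<close> of
  degree at most \<open>2n\<close>, the odd ones are \<open>\<kappa>\<close> times the odd polynomials of degree below \<open>2n\<close>, and
  \<open>dx\<close> is a constant times \<open>du / \<kappa>(u)\<close>. The Fourier extension thus turns into two polynomial
  projections in \<open>L\<^sup>2\<close> spaces with the weights \<open>1 / \<kappa>\<close> and \<open>\<kappa>\<close>, both Lipschitz and bounded away
  from zero (lemmas \<open>orthogonal_poly\<close>, \<open>real_fourier_extension_rate\<close>).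

  For such a weight \<open>\<omega>\<close>, a polynomial \<open>Q\<close> which is the projection of \<open>h\<close> satisfies, with
  \<open>K\<close> the reproducing kernel for the constant weight,
  \<open>\<omega>(x) Q(x) = \<integral> Q(y) (\<omega>(x) - \<omega>(y)) K(x,y) dy + \<integral> h(y) \<omega>(y) K(x,y) dy\<close>
  (Korous' comparison argument, \<open>weighted_projection_bound\<close>). This reduces everything to two
  estimates of the Legendre kernel: the \<open>L\<^sup>2\<close> norm of \<open>y \<mapsto> (x - y) K(x,y)\<close> is \<open>O(m\<^sup>1\<^sup>/\<^sup>2)\<close>
  (\<open>legendre_kernel_moment\<close>), and the Lebesgue function is \<open>O((m ln m)\<^sup>1\<^sup>/\<^sup>2)\<close>
  (\<open>legendre_Lebesgue_function_le\<close>). Both rest on the bounds \<open>p\<^sub>n(x)\<^sup>2 \<le> 2n + 1\<close> and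
  \<open>p\<^sub>n(x)\<^sup>2 (1 - \<bar>x\<bar>) \<le> 2\<close> for the orthonormal Legendre polynomials, which follow from the
  monotonicity of Sonin's function. Together with a polynomial approximation theorem of
  Jackson type (\<open>holder_polynomial_approximation\<close>), applied to \<open>h = f - P\<close>, they give the
  convergence rate \<open>O(N\<^sup>1\<^sup>/\<^sup>2\<^sup>-\<^sup>\<alpha> (ln N)\<^sup>1\<^sup>/\<^sup>2)\<close>.
\<close>

section \<open>Integration of polynomials over the interval from -1 to 1\<close>

text \<open>
  The linear functional \<open>p \<mapsto> \<integral> p\<close> over \<open>[-1,1]\<close>; the inner product of \<open>p\<close> and \<open>q\<close> is
  \<open>poly_int (p * q)\<close>.
\<close>

definition poly_int :: "real poly \<Rightarrow> real" where
  "poly_int p = integral {-1..1} (poly p)"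

lemma poly_integrable: "poly (p :: real poly) integrable_on {a..b}"
  by (intro integrable_continuous_interval continuous_intros)

lemma poly_int_add [simp]: "poly_int (p + q) = poly_int p + poly_int q"
proof -
  have "poly (p + q) = (\<lambda>x. poly p x + poly q x)" by (simp add: fun_eq_iff)
  thus ?thesis unfolding poly_int_def by (simp add: integral_add poly_integrable)
qed

lemma poly_int_smult [simp]: "poly_int (smult c p) = c * poly_int p"
proof -
  have "poly (smult c p) = (\<lambda>x. c * poly p x)" by (simp add: fun_eq_iff)
  thus ?thesis unfolding poly_int_def by simp
qed

lemma poly_int_0 [simp]: "poly_int 0 = 0"
  using poly_int_smult[of 0 0] by simp

lemma poly_int_minus [simp]: "poly_int (- p) = - poly_int p"
  using poly_int_smult[of "-1" p] by simp

lemma poly_int_diff [simp]: "poly_int (p - q) = poly_int p - poly_int q"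
  using poly_int_add[of p "- q"] by simp

lemma poly_int_sum: "poly_int (sum f A) = (\<Sum>i\<in>A. poly_int (f i))"
  by (induction A rule: infinite_finite_induct) auto

lemma poly_int_pderiv: "poly_int (pderiv p) = poly p 1 - poly p (-1)"
proof -
  have "(poly (pderiv p) has_integral poly p 1 - poly p (-1)) {-1..1}"
    by (rule fundamental_theorem_of_calculus)
       (auto intro!: has_field_derivative_at_within poly_DERIV
             simp flip: has_real_derivative_iff_has_vector_derivative)
  thus ?thesis unfolding poly_int_def by (rule integral_unique)
qed

lemma poly_int_nonneg:
  assumes "\<And>x. x \<in> {-1..1} \<Longrightarrow> poly p x \<ge> 0"
  shows "poly_int p \<ge> 0"
  unfolding poly_int_def by (rule integral_nonneg) (auto intro: poly_integrable assms)

lemma poly_int_mono: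
  assumes "\<And>x. x \<in> {-1..1} \<Longrightarrow> poly p x \<le> poly q x"
  shows "poly_int p \<le> poly_int q"
  using poly_int_nonneg[of "q - p"] assms by simp

lemma poly_int_square_pos:
  assumes "p \<noteq> 0"
  shows "poly_int (p * p) > 0"
proof (rule ccontr)
  assume "\<not> poly_int (p * p) > 0"
  moreover have "poly_int (p * p) \<ge> 0" by (rule poly_int_nonneg) simp
  ultimately have "integral {-1..1} (poly (p * p)) = 0" by (simp add: poly_int_def)
  hence "\<forall>x\<in>{-1..1}. poly (p * p) x = 0"
    by (subst (asm) integral_eq_0_iff) (auto intro!: continuous_intros)
  hence "{-1..1::real} \<subseteq> {x. poly p x = 0}" by auto
  moreover have "finite {x. poly p x = 0}" using assms by (rule poly_roots_finite)
  ultimately have "finite {-1..1::real}" by (rule finite_subset)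
  thus False using infinite_Icc[of "-1::real" 1] by simp
qed

lemma integral_Cauchy_Schwarz:
  fixes f g :: "real \<Rightarrow> real"
  assumes f: "continuous_on {a..b} f" and g: "continuous_on {a..b} g"
  shows "(integral {a..b} (\<lambda>x. f x * g x))\<^sup>2
           \<le> integral {a..b} (\<lambda>x. (f x)\<^sup>2) * integral {a..b} (\<lambda>x. (g x)\<^sup>2)"
proof -
  define A where "A = integral {a..b} (\<lambda>x. (f x)\<^sup>2)"
  define B where "B = integral {a..b} (\<lambda>x. f x * g x)"
  define C where "C = integral {a..b} (\<lambda>x. (g x)\<^sup>2)"
  have [simp]: "(\<lambda>x. (f x)\<^sup>2) integrable_on {a..b}" "(\<lambda>x. f x * g x) integrable_on {a..b}"
    "(\<lambda>x. (g x)\<^sup>2) integrable_on {a..b}"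
    by (intro integrable_continuous_interval continuous_intros f g)+
  have nn: "s\<^sup>2 * A - 2 * s * t * B + t\<^sup>2 * C \<ge> 0" for s t
  proof -
    have "0 \<le> integral {a..b} (\<lambda>x. (s * f x - t * g x)\<^sup>2)"
      by (rule integral_nonneg) (auto intro!: integrable_continuous_interval continuous_intros f g)
    also have "(\<lambda>x. (s * f x - t * g x)\<^sup>2)
        = (\<lambda>x. s\<^sup>2 * (f x)\<^sup>2 - 2 * s * t * (f x * g x) + t\<^sup>2 * (g x)\<^sup>2)"
      by (simp add: power2_eq_square algebra_simps)
    also have "integral {a..b} \<dots> = s\<^sup>2 * A - 2 * s * t * B + t\<^sup>2 * C"
      unfolding A_def B_def C_def
      by (simp add: integral_add integral_diff integrable_diff integrable_on_mult_right)
    finally show ?thesis .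
  qed
  have C0: "C \<ge> 0" unfolding C_def by (rule integral_nonneg) auto
  show ?thesis
  proof (cases "C = 0")
    case True
    have "B = 0"
    proof (rule ccontr)
      assume "B \<noteq> 0"
      show False using nn[of 1 "(A + 1) / (2 * B)"] \<open>B \<noteq> 0\<close> True by simp
    qed
    thus ?thesis using True unfolding A_def B_def C_def by simp
  next
    case False
    have "C * (C * A - B\<^sup>2) \<ge> 0"
      using nn[of C B] by (simp add: power2_eq_square algebra_simps)
    hence "C * A - B\<^sup>2 \<ge> 0" using C0 False by (simp add: zero_le_mult_iff)
    thus ?thesis unfolding A_def B_def C_def by (simp add: mult.commute)
  qed
qed

lemma integral_abs_le_sqrt:
  fixes f g :: "real \<Rightarrow> real"
  assumes "continuous_on {a..b} f" and "continuous_on {a..b} g"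
  shows "\<bar>integral {a..b} (\<lambda>x. f x * g x)\<bar>
           \<le> sqrt (integral {a..b} (\<lambda>x. (f x)\<^sup>2)) * sqrt (integral {a..b} (\<lambda>x. (g x)\<^sup>2))"
  using real_sqrt_le_mono[OF integral_Cauchy_Schwarz[OF assms]]
  by (simp add: real_sqrt_mult)

section \<open>Orthonormal Legendre polynomials\<close>

text \<open>
  Rodrigues' formula, without the usual factor \<open>1 / (2\<^sup>n n!)\<close>.
\<close>

definition rodrigues :: "nat \<Rightarrow> real poly" where
  "rodrigues n = (pderiv ^^ n) ([:-1, 0, 1:] ^ n)"

lemma degree_funpow_pderiv:
  "degree ((pderiv ^^ k) (p :: real poly)) = degree p - k"
  by (induction k) (auto simp: degree_pderiv)

lemma degree_rodrigues [simp]: "degree (rodrigues n) = n"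
  by (simp add: rodrigues_def degree_funpow_pderiv degree_power_eq)

lemma rodrigues_nonzero [simp]: "rodrigues n \<noteq> 0"
proof
  assume "rodrigues n = 0"
  moreover from this have "n = 0" using degree_rodrigues[of n] by simp
  ultimately show False by (simp add: rodrigues_def)
qed

text \<open>
  Legendre's differential equation. The polynomial \<open>v = (x\<^sup>2 - 1)\<^sup>n\<close> satisfies
  \<open>(x\<^sup>2 - 1) v' = 2 n x v\<close>; differentiating this \<open>j + 1\<close> times gives a second-order equation for the
  \<open>j\<close>-th derivative of \<open>v\<close>, which is Legendre's equation for \<open>j = n\<close>.
\<close>

lemma rodrigues_ODE:
  "pderiv ([:-1, 0, 1:] * pderiv (rodrigues n)) = smult (real n * (real n + 1)) (rodrigues n)"
proof -
  \<comment> \<open>Of \<open>X = x\<close> and \<open>W = x\<^sup>2 - 1\<close>, only the derivatives matter for the recursion.\<close>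
  obtain X W :: "real poly" where X: "pderiv X = 1" and W: "pderiv W = smult 2 X"
    and W_eq: "W = [:-1, 0, 1:]"
    by (rule that[of "[:0, 1:]" "[:-1, 0, 1:]"]) (auto simp: pderiv_pCons)
  define v where "v = W ^ n"
  have v1: "W * pderiv v = smult (2 * real n) (X * v)"
  proof (cases n)
    case (Suc k)
    have "pderiv v = smult (2 * real n) (X * W ^ k)"
      unfolding v_def Suc pderiv_power_Suc W by (simp add: mult.commute)
    thus ?thesis by (simp add: v_def Suc algebra_simps)
  qed (simp add: v_def)
  have D: "W * (pderiv ^^ (j + 2)) v + smult (2 - 2 * real n + 2 * real j) (X * (pderiv ^^ (j + 1)) v)
        = smult (2 * real n + 2 * real n * real j - real j * (real j + 1)) ((pderiv ^^ j) v)" for j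
  proof (induction j)
    case 0
    have "pderiv (W * pderiv v) = pderiv (smult (2 * real n) (X * v))"
      by (simp only: v1)
    thus ?case
      by (simp add: pderiv_mult pderiv_smult X W smult_add_right smult_diff_left algebra_simps)
  next
    case (Suc j)
    define c where "c = 2 - 2 * real n + 2 * real j"
    define d where "d = 2 * real n + 2 * real n * real j - real j * (real j + 1)"
    define E where "E = (pderiv ^^ j) v"
    have "pderiv (W * pderiv (pderiv E) + smult c (X * pderiv E)) = pderiv (smult d E)"
      using Suc by (simp add: c_def d_def E_def)
    hence "W * pderiv (pderiv (pderiv E)) + smult (c + 2) (X * pderiv (pderiv E))
             = smult (d - c) (pderiv E)"
      by (simp add: pderiv_mult pderiv_smult pderiv_add X W smult_add_right smult_add_left
            smult_diff_left algebra_simps)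
    moreover have "c + 2 = 2 - 2 * real n + 2 * real (Suc j)"
      and "d - c = 2 * real n + 2 * real n * real (Suc j) - real (Suc j) * (real (Suc j) + 1)"
      by (simp_all add: c_def d_def algebra_simps)
    ultimately show ?case by (simp add: E_def)
  qed
  have "pderiv (W * pderiv ((pderiv ^^ n) v)) = smult (real n * (real n + 1)) ((pderiv ^^ n) v)"
    using D[of n] by (simp add: pderiv_mult W algebra_simps)
  thus ?thesis by (simp add: rodrigues_def v_def W_eq)
qed

text \<open>
  Integration by parts, in which the boundary terms vanish. The right-hand side is symmetric in
  \<open>p\<close> and \<open>q\<close>, and so is the operator.
\<close>

lemma poly_int_legendre_operator:
  "poly_int (pderiv ([:-1, 0, 1:] * pderiv p) * q)
     = poly_int ([:1, 0, -1:] * (pderiv p * pderiv q))"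
proof -
  define W :: "real poly" where "W = [:-1, 0, 1:]"
  have W': "[:1, 0, -1:] = - W" by (simp add: W_def)
  have "poly_int (pderiv (W * pderiv p * q)) = 0"
    by (simp add: poly_int_pderiv W_def)
  hence "poly_int (W * pderiv p * pderiv q + q * pderiv (W * pderiv p)) = 0"
    unfolding pderiv_mult[of "W * pderiv p" q] .
  thus ?thesis unfolding W' W_def[symmetric]
    by (simp add: mult_ac)
qed

lemma rodrigues_orthogonal:
  assumes "m \<noteq> n"
  shows "poly_int (rodrigues m * rodrigues n) = 0"
proof -
  let ?I = "poly_int (rodrigues m * rodrigues n)"
  have "(real m * (real m + 1)) * ?I = (real n * (real n + 1)) * ?I"
    using poly_int_legendre_operator[of "rodrigues m" "rodrigues n"]
      poly_int_legendre_operator[of "rodrigues n" "rodrigues m"]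
    unfolding rodrigues_ODE by (simp add: mult.commute)
  moreover have "real m * (real m + 1) \<noteq> real n * (real n + 1)"
  proof
    assume "real m * (real m + 1) = real n * (real n + 1)"
    hence "(real m - real n) * (real m + real n + 1) = 0" by (simp add: algebra_simps)
    thus False using assms by (auto simp: add_eq_0_iff)
  qed
  ultimately show ?thesis by simp
qed

text \<open>
  The Legendre polynomials normalized to have norm 1 in \<open>L\<^sup>2(-1,1)\<close>.
\<close>

definition legendre :: "nat \<Rightarrow> real poly" where
  "legendre n = smult (1 / sqrt (poly_int (rodrigues n * rodrigues n))) (rodrigues n)"

lemma legendre_factor_pos: "poly_int (rodrigues n * rodrigues n) > 0"
  by (simp add: poly_int_square_pos)

lemma degree_legendre [simp]: "degree (legendre n) = n"
  using legendre_factor_pos[of n] by (simp add: legendre_def)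

lemma legendre_nonzero [simp]: "legendre n \<noteq> 0"
  using legendre_factor_pos[of n] by (simp add: legendre_def)

lemma legendre_ODE:
  "pderiv ([:-1, 0, 1:] * pderiv (legendre n)) = smult (real n * (real n + 1)) (legendre n)"
  unfolding legendre_def pderiv_smult mult_smult_right rodrigues_ODE
  by (simp add: mult.commute)

lemma legendre_orthonormal:
  "poly_int (legendre m * legendre n) = (if m = n then 1 else 0)"
  using legendre_factor_pos[of n] rodrigues_orthogonal[of m n]
  by (auto simp: legendre_def field_simps)

lemma legendre_expansion:
  assumes "degree p < m"
  shows "p = (\<Sum>k<m. smult (poly_int (p * legendre k)) (legendre k))"
proof -
  have "\<exists>c. p = (\<Sum>k<m. smult (c k) (legendre k))"
    using assms
  proof (induction m arbitrary: p)
    case (Suc m)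
    define a where "a = coeff p m / coeff (legendre m) m"
    define q where "q = p - smult a (legendre m)"
    have lc: "coeff (legendre m) m \<noteq> 0"
      using legendre_nonzero[of m] degree_legendre[of m] by (metis leading_coeff_0_iff)
    have q0: "coeff q m = 0" using lc by (simp add: q_def a_def)
    have dq: "degree q \<le> m"
      unfolding q_def using Suc.prems by (intro degree_diff_le) (auto simp: degree_smult_le le_trans[OF degree_smult_le])
    have "\<exists>c. q = (\<Sum>k<m. smult (c k) (legendre k))"
    proof (cases "q = 0")
      case True
      thus ?thesis by (intro exI[of _ "\<lambda>_. 0"]) simp
    next
      case False
      with q0 have "degree q \<noteq> m" by (metis leading_coeff_0_iff)
      thus ?thesis using dq Suc.IH[of q] by simp
    qed
    then obtain c where c: "q = (\<Sum>k<m. smult (c k) (legendre k))" by blast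
    have "p = q + smult a (legendre m)" by (simp add: q_def)
    also have "q = (\<Sum>k<m. smult ((c(m := a)) k) (legendre k))" unfolding c by (intro sum.cong) auto
    finally show ?case by (intro exI[of _ "c(m := a)"]) simp
  qed simp
  then obtain c where c: "p = (\<Sum>k<m. smult (c k) (legendre k))" by blast
  have "poly_int (p * legendre j) = c j" if "j < m" for j
    unfolding c sum_distrib_right poly_int_sum mult_smult_left poly_int_smult legendre_orthonormal
    using that by (simp add: if_distrib[of "\<lambda>x. _ * x"] cong: if_cong)
  thus ?thesis using c by simp
qed

lemma legendre_orthogonal_lower:
  assumes "degree p < n"
  shows "poly_int (p * legendre n) = 0"
proof -
  have "p * legendre n = (\<Sum>k<n. smult (poly_int (p * legendre k)) (legendre k)) * legendre n"
    by (subst legendre_expansion[OF assms]) (rule refl)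
  thus ?thesis
    by (simp add: sum_distrib_right poly_int_sum legendre_orthonormal)
qed

text \<open>
  The polynomial \<open>d = x p' - n p\<close>, with \<open>p\<close> the \<open>n\<close>-th Legendre polynomial, has degree below \<open>n\<close> and is
  thus orthogonal to \<open>p\<close>. Hence \<open>\<integral> (x p\<^sup>2)' = \<integral> p\<^sup>2 + 2 \<integral> x p' p = 1 + 2n\<close>.
\<close>

lemma legendre_endpoints: "(poly (legendre n) 1)\<^sup>2 + (poly (legendre n) (-1))\<^sup>2 = 2 * real n + 1"
proof -
  let ?l = "legendre n"
  define d where "d = pCons 0 (pderiv ?l) - smult (real n) ?l"
  have cd: "coeff d i = 0" if "i \<ge> n" for i
  proof (cases "i = n")
    case True
    thus ?thesis by (cases n) (auto simp: d_def coeff_pCons coeff_pderiv)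
  next
    case False
    hence "coeff ?l i = 0" using that by (intro coeff_eq_0) simp
    thus ?thesis using that False by (cases i) (auto simp: d_def coeff_pCons coeff_pderiv)
  qed
  have d0: "poly_int (d * ?l) = 0"
  proof (cases "d = 0")
    case False
    hence "degree d < n" using cd[of "degree d"] by (metis leading_coeff_0_iff not_le)
    thus ?thesis by (rule legendre_orthogonal_lower)
  qed simp
  have "smult 2 a = a + a" for a :: "real poly"
    using smult_add_left[of 1 1 a] by simp
  hence "pderiv ([:0, 1:] * (?l * ?l)) = ?l * ?l + smult 2 ([:0,1:] * pderiv ?l * ?l)"
    by (simp add: pderiv_mult pderiv_pCons algebra_simps)
  also have "[:0,1:] * pderiv ?l = d + smult (real n) ?l" by (simp add: d_def)
  finally have "poly_int (pderiv ([:0, 1:] * (?l * ?l))) = 2 * real n + 1"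
    by (simp add: distrib_right d0 legendre_orthonormal)
  thus ?thesis by (simp add: poly_int_pderiv power2_eq_square)
qed

text \<open>
  Sonin's function \<open>p\<^sup>2 + (1 - x\<^sup>2) p'\<^sup>2 / (n (n + 1))\<close> of the \<open>n\<close>-th Legendre polynomial \<open>p\<close>. It
  dominates \<open>p\<^sup>2\<close>, agrees with it at the endpoints, has integral 2 and is increasing in \<open>\<bar>x\<bar>\<close>, all of
  this for \<open>n > 0\<close>.
\<close>

definition sonin :: "nat \<Rightarrow> real poly" where
  "sonin n = legendre n * legendre n
     + smult (1 / (real n * (real n + 1))) ([:1, 0, -1:] * (pderiv (legendre n) * pderiv (legendre n)))"

lemma poly_sonin_ge:
  assumes "x \<in> {-1..1}"
  shows "(poly (legendre n) x)\<^sup>2 \<le> poly (sonin n) x"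
proof -
  have "x\<^sup>2 \<le> 1" using assms by (auto simp: abs_square_le_1)
  hence "0 \<le> 1 / (real n * (real n + 1)) * ((1 - x\<^sup>2) * (poly (pderiv (legendre n)) x)\<^sup>2)"
    by (intro mult_nonneg_nonneg) auto
  thus ?thesis by (simp add: sonin_def power2_eq_square algebra_simps)
qed

lemma pderiv_sonin:
  assumes "n > 0"
  shows "pderiv (sonin n)
     = smult (2 / (real n * (real n + 1))) ([:0, 1:] * (pderiv (legendre n) * pderiv (legendre n)))"
proof -
  define c where "c = real n * (real n + 1)"
  have c: "c \<noteq> 0" using assms by (simp add: c_def)
  define X :: "real poly" where "X = [:0, 1:]"
  define W :: "real poly" where "W = [:-1, 0, 1:]"
  have W': "[:1, 0, -1:] = - W" by (simp add: W_def)
  have W2: "pderiv W = X + X" by (simp add: W_def X_def pderiv_pCons)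
  define l where "l = legendre n"
  define d where "d = pderiv l"
  have two: "smult (2 / c) a = smult (1 / c) (a + a)" for a :: "real poly"
    using smult_add_left[of "1 / c" "1 / c" a] by (simp add: smult_add_right)
  have "pderiv (W * d) = smult c l"
    using legendre_ODE[of n] by (simp add: W_def l_def d_def c_def)
  hence ode: "W * pderiv d = smult c l - (X * d + X * d)"
    by (simp add: pderiv_mult W2 algebra_simps)
  have "pderiv (sonin n) = l * d + l * d
      + smult (1 / c) (- (d * (W * pderiv d) + d * (W * pderiv d)) - (X * d * d + X * d * d))"
    unfolding sonin_def W' l_def[symmetric] d_def[symmetric] c_def[symmetric]
    by (simp add: pderiv_add pderiv_diff pderiv_smult pderiv_mult pderiv_minus W2 d_def
        smult_add_right smult_diff_right smult_minus_right algebra_simps)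
  also have "\<dots> = smult (1 / c) (smult c (l * d + l * d)
      + (- (d * (W * pderiv d) + d * (W * pderiv d)) - (X * d * d + X * d * d)))"
    using c by (simp add: smult_add_right)
  also have "\<dots> = smult (1 / c) (X * d * d + X * d * d)"
    unfolding ode by (rule arg_cong[where f = "smult (1 / c)"]) (simp add: algebra_simps smult_add_right)
  also have "\<dots> = smult (2 / c) (X * (d * d))"
    by (simp add: two mult.assoc)
  finally show ?thesis by (simp add: c_def X_def d_def l_def)
qed

lemma poly_int_sonin:
  assumes "n > 0"
  shows "poly_int (sonin n) = 2"
proof -
  have "poly_int ([:1, 0, -1:] * (pderiv (legendre n) * pderiv (legendre n)))
      = real n * (real n + 1)"
    unfolding poly_int_legendre_operator[symmetric] legendre_ODE
    by (simp add: legendre_orthonormal)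
  thus ?thesis unfolding sonin_def poly_int_add poly_int_smult
    using assms by (simp add: legendre_orthonormal)
qed

lemma poly_sonin_mono_abs:
  assumes n: "n > 0" and s: "s = 1 \<or> s = -1" and xy: "0 \<le> x" "x \<le> y"
  shows "poly (sonin n) (s * x) \<le> poly (sonin n) (s * y)"
proof (rule DERIV_nonneg_imp_nondecreasing[OF xy(2)])
  fix t assume t: "x \<le> t" "t \<le> y"
  let ?D = "poly (pderiv (sonin n)) (s * t) * s"
  have "((\<lambda>t. poly (sonin n) (s * t)) has_real_derivative ?D) (at t)"
    by (rule DERIV_chain2[OF poly_DERIV]) (auto intro!: derivative_eq_intros)
  moreover have "?D = 2 / (real n * (real n + 1)) * (s\<^sup>2 * t * (poly (pderiv (legendre n)) (s * t))\<^sup>2)"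
    unfolding pderiv_sonin[OF n] by (simp add: power2_eq_square)
  moreover have "\<dots> \<ge> 0" using t xy by simp
  ultimately show "\<exists>D. ((\<lambda>t. poly (sonin n) (s * t)) has_real_derivative D) (at t) \<and> 0 \<le> D"
    by auto
qed

lemma legendre_bound:
  assumes x: "x \<in> {-1..1}"
  shows "(poly (legendre n) x)\<^sup>2 \<le> 2 * real n + 1"
proof (cases "n = 0")
  case True
  obtain c where c: "legendre 0 = [:c:]"
    using degree_legendre[of 0] by (metis degree_eq_zeroE)
  show ?thesis using legendre_endpoints[of 0] unfolding True c by simp
next
  case False
  define s :: real where "s = (if x \<ge> 0 then 1 else -1)"
  have s: "s = 1 \<or> s = -1" "x = s * \<bar>x\<bar>" by (auto simp: s_def)
  have "(poly (legendre n) x)\<^sup>2 \<le> poly (sonin n) (s * \<bar>x\<bar>)"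
    using poly_sonin_ge[OF x] s(2) by simp
  also have "\<dots> \<le> poly (sonin n) (s * 1)"
    using x False s(1) by (intro poly_sonin_mono_abs) auto
  also have "\<dots> = (poly (legendre n) s)\<^sup>2"
    using s(1) by (auto simp: sonin_def power2_eq_square)
  also have "\<dots> \<le> 2 * real n + 1"
    using s(1) legendre_endpoints[of n] zero_le_power2[of "poly (legendre n) 1"] zero_le_power2[of "poly (legendre n) (-1)"]
    by (elim disjE; hypsubst; linarith)
  finally show ?thesis .
qed

text \<open>
  As Sonin's function \<open>S\<close> increases from \<open>\<bar>x\<bar>\<close> to 1, the number \<open>S(x) (1 - \<bar>x\<bar>)\<close> is at most the
  integral of \<open>S\<close> between \<open>x\<close> and the nearest endpoint.
\<close>

lemma legendre_bound_interior:
  assumes x: "x \<in> {-1..1}"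
  shows "(poly (legendre n) x)\<^sup>2 * (1 - \<bar>x\<bar>) \<le> 2"
proof (cases "n = 0")
  case True
  have "(poly (legendre 0) x)\<^sup>2 * (1 - \<bar>x\<bar>) \<le> 1 * 1"
    using legendre_bound[OF x, of 0] x by (intro mult_mono) auto
  thus ?thesis by (simp add: True)
next
  case False
  define s :: real where "s = (if x \<ge> 0 then 1 else -1)"
  have s: "s = 1 \<or> s = -1" "x = s * \<bar>x\<bar>" by (auto simp: s_def)
  define S where "S = poly (sonin n) x"
  have S0: "poly (sonin n) t \<ge> 0" if "t \<in> {-1..1}" for t
    using poly_sonin_ge[OF that, of n] by (rule order_trans[rotated]) simp
  define A where "A = (if x \<ge> 0 then {x..1} else {-1..x})"
  have A: "A \<subseteq> {-1..1}" using x by (auto simp: A_def)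
  have "S * (1 - \<bar>x\<bar>) = integral A (\<lambda>_. S)"
    using x by (simp add: A_def)
  also have "\<dots> \<le> integral A (poly (sonin n))"
  proof (rule integral_le)
    show "(\<lambda>_. S) integrable_on A" "poly (sonin n) integrable_on A"
      by (auto simp: A_def poly_integrable)
    fix t assume t: "t \<in> A"
    have "t = s * \<bar>t\<bar>" "\<bar>x\<bar> \<le> \<bar>t\<bar>" using t by (auto simp: A_def s_def split: if_splits)
    thus "S \<le> poly (sonin n) t"
      using poly_sonin_mono_abs[OF _ s(1), of n "\<bar>x\<bar>" "\<bar>t\<bar>"] False s(2) by (simp add: S_def)
  qed
  also have "\<dots> \<le> poly_int (sonin n)"
    unfolding poly_int_def
    by (rule integral_subset_le) (use A S0 in \<open>auto simp: A_def poly_integrable\<close>)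
  also have "\<dots> = 2" using False by (simp add: poly_int_sonin)
  finally have "S * (1 - \<bar>x\<bar>) \<le> 2" .
  moreover have "(poly (legendre n) x)\<^sup>2 * (1 - \<bar>x\<bar>) \<le> S * (1 - \<bar>x\<bar>)"
    using x poly_sonin_ge[OF x, of n] by (intro mult_right_mono) (auto simp: S_def)
  ultimately show ?thesis by linarith
qed

section \<open>The Legendre reproducing kernel\<close>

lemma poly_int_Cauchy_Schwarz:
  "(poly_int (p * q))\<^sup>2 \<le> poly_int (p * p) * poly_int (q * q)"
proof -
  have "poly (a * b) = (\<lambda>x. poly a x * poly b x)" for a b :: "real poly"
    by (simp add: fun_eq_iff)
  thus ?thesis
    using integral_Cauchy_Schwarz[of "-1" 1 "poly p" "poly q"]
    by (simp add: poly_int_def power2_eq_square continuous_on_poly[OF continuous_on_id])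
qed

text \<open>
  The reproducing kernel of the polynomials of degree less than \<open>m\<close> in \<open>L\<^sup>2(-1,1)\<close>, as a polynomial
  in its second variable.
\<close>

definition legendre_kernel :: "nat \<Rightarrow> real \<Rightarrow> real poly" where
  "legendre_kernel m x = (\<Sum>k<m. smult (poly (legendre k) x) (legendre k))"

lemma legendre_kernel_Suc:
  "legendre_kernel (Suc m) x = legendre_kernel m x + smult (poly (legendre m) x) (legendre m)"
  by (simp add: legendre_kernel_def)

lemma degree_legendre_kernel: "degree (legendre_kernel m x) \<le> m - 1"
  unfolding legendre_kernel_def
  by (intro degree_sum_le) (auto intro: order_trans[OF degree_smult_le])

lemma legendre_kernel_reproducing:
  assumes "degree p < m"
  shows "poly_int (p * legendre_kernel m x) = poly p x"
proof -
  have "poly_int (p * legendre_kernel m x)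
      = (\<Sum>k<m. poly_int (p * legendre k) * poly (legendre k) x)"
    by (simp add: legendre_kernel_def sum_distrib_left poly_int_sum mult.commute)
  also have "\<dots> = poly (\<Sum>k<m. smult (poly_int (p * legendre k)) (legendre k)) x"
    by (simp add: poly_sum)
  finally show ?thesis using legendre_expansion[OF assms] by simp
qed

lemma legendre_kernel_diagonal:
  "poly (legendre_kernel m x) x = (\<Sum>k<m. (poly (legendre k) x)\<^sup>2)"
  by (simp add: legendre_kernel_def poly_sum power2_eq_square)

lemma legendre_kernel_norm:
  "poly_int (legendre_kernel m x * legendre_kernel m x) = poly (legendre_kernel m x) x"
proof (cases m)
  case (Suc k)
  thus ?thesis using degree_legendre_kernel[of m x] by (intro legendre_kernel_reproducing) simp
qed (simp add: legendre_kernel_def)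

lemma legendre_kernel_diagonal_le:
  assumes "x \<in> {-1..1}"
  shows "poly (legendre_kernel m x) x \<le> real m ^ 2"
proof -
  have "poly (legendre_kernel m x) x \<le> (\<Sum>k<m. 2 * real k + 1)"
    unfolding legendre_kernel_diagonal by (intro sum_mono legendre_bound assms)
  also have "\<dots> = real m ^ 2"
    by (induction m) (auto simp: power2_eq_square algebra_simps)
  finally show ?thesis .
qed

lemma legendre_kernel_diagonal_interior_le:
  assumes "x \<in> {-1..1}"
  shows "(1 - \<bar>x\<bar>) * poly (legendre_kernel m x) x \<le> 2 * real m"
proof -
  have "(1 - \<bar>x\<bar>) * poly (legendre_kernel m x) x
      = (\<Sum>k<m. (poly (legendre k) x)\<^sup>2 * (1 - \<bar>x\<bar>))"
    unfolding legendre_kernel_diagonal by (simp add: sum_distrib_left mult.commute)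
  also have "\<dots> \<le> (\<Sum>k<m. 2)"
    by (intro sum_mono legendre_bound_interior assms)
  finally show ?thesis by simp
qed

text \<open>
  A substitute for the Christoffel--Darboux formula. The polynomial \<open>\<psi> = (x - y) K\<close> has degree at most
  \<open>m\<close>, and \<open>(x - y) \<psi>\<close> vanishes at \<open>x\<close>, hence is orthogonal to the kernel of index \<open>m + 2\<close>. Therefore
  \<open>\<integral> \<psi>\<^sup>2 = \<integral> K (x - y) \<psi> = - \<integral> \<Delta> (x - y) \<psi>\<close>, where \<open>\<Delta>\<close> consists of the two terms by which the
  kernels differ.
\<close>

lemma legendre_kernel_moment:
  assumes x: "x \<in> {-1..1}"
  shows "poly_int (([:x, -1:] * legendre_kernel m x) * ([:x, -1:] * legendre_kernel m x))
           \<le> 16 * (real m + 1)"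
proof -
  define K where "K = legendre_kernel m x"
  define X where "X = [:x, -1:]"
  define \<psi> where "\<psi> = X * K"
  define \<Delta> where "\<Delta> = smult (poly (legendre m) x) (legendre m)
    + smult (poly (legendre (Suc m)) x) (legendre (Suc m))"
  have K2: "legendre_kernel (m + 2) x = K + \<Delta>"
    by (simp add: legendre_kernel_Suc K_def \<Delta>_def numeral_2_eq_2)
  have deg: "degree (X * \<psi>) < m + 2"
  proof (cases m)
    case 0
    thus ?thesis by (simp add: \<psi>_def K_def legendre_kernel_def)
  next
    case (Suc k)
    have "degree (X * \<psi>) \<le> degree X + (degree X + degree K)"
      unfolding \<psi>_def by (intro order_trans[OF degree_mult_le] add_left_mono degree_mult_le)
    also have "\<dots> \<le> 2 + (m - 1)"
      using degree_legendre_kernel[of m x] by (simp add: X_def K_def)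
    finally show ?thesis using Suc by simp
  qed
  have "poly_int (X * \<psi> * legendre_kernel (m + 2) x) = poly (X * \<psi>) x"
    using deg by (rule legendre_kernel_reproducing)
  hence "poly_int (X * \<psi> * K) + poly_int (X * \<psi> * \<Delta>) = 0"
    unfolding K2 by (simp add: X_def distrib_left del: mult_pCons_left)
  hence "poly_int (\<psi> * \<psi>) = - poly_int (\<Delta> * (X * \<psi>))"
    by (simp add: \<psi>_def mult_ac)
  hence "(poly_int (\<psi> * \<psi>))\<^sup>2 \<le> poly_int (\<Delta> * \<Delta>) * poly_int ((X * \<psi>) * (X * \<psi>))"
    using poly_int_Cauchy_Schwarz[of \<Delta> "X * \<psi>"] by simp
  also have "\<dots> \<le> (4 * (real m + 1)) * (4 * poly_int (\<psi> * \<psi>))"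
  proof (rule mult_mono)
    have "poly_int (\<Delta> * \<Delta>) = (poly (legendre m) x)\<^sup>2 + (poly (legendre (Suc m)) x)\<^sup>2"
      by (simp add: \<Delta>_def distrib_left distrib_right legendre_orthonormal power2_eq_square)
    also have "\<dots> \<le> 4 * (real m + 1)"
      using legendre_bound[OF x, of m] legendre_bound[OF x, of "Suc m"] by simp
    finally show "poly_int (\<Delta> * \<Delta>) \<le> 4 * (real m + 1)" .
    have "poly_int ((X * \<psi>) * (X * \<psi>)) \<le> poly_int (smult 4 (\<psi> * \<psi>))"
    proof (rule poly_int_mono)
      fix y :: real assume y: "y \<in> {-1..1}"
      have "\<bar>x - y\<bar> \<le> 2" using x y by auto
      hence "\<bar>x - y\<bar>\<^sup>2 \<le> 2\<^sup>2" by (intro power_mono) auto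
      hence "(x - y)\<^sup>2 * (poly \<psi> y)\<^sup>2 \<le> 4 * (poly \<psi> y)\<^sup>2"
        by (intro mult_right_mono) auto
      thus "poly ((X * \<psi>) * (X * \<psi>)) y \<le> poly (smult 4 (\<psi> * \<psi>)) y"
        by (simp add: X_def power2_eq_square algebra_simps)
    qed
    thus "poly_int ((X * \<psi>) * (X * \<psi>)) \<le> 4 * poly_int (\<psi> * \<psi>)" by simp
  qed (auto intro: poly_int_nonneg)
  finally have "poly_int (\<psi> * \<psi>) * poly_int (\<psi> * \<psi>) \<le> 16 * (real m + 1) * poly_int (\<psi> * \<psi>)"
    by (simp add: power2_eq_square algebra_simps)
  moreover have "poly_int (\<psi> * \<psi>) \<ge> 0" by (rule poly_int_nonneg) simp
  ultimately have "poly_int (\<psi> * \<psi>) \<le> 16 * (real m + 1)"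
    by (cases "poly_int (\<psi> * \<psi>) = 0") auto
  thus ?thesis unfolding \<psi>_def X_def K_def .
qed

text \<open>
  The sign \<open>s\<close> selects the endpoint closest to \<open>x\<close>. Write \<open>1 - s y = (1 - \<bar>x\<bar>) + s (x - y)\<close>: the
  first term is controlled by the interior bound. In the second, \<open>(x - y) K\<close> is orthogonal to the
  kernel of index \<open>m - 1\<close> at \<open>x\<close>, so that only the last term of \<open>K\<close> contributes.
\<close>

lemma legendre_kernel_weighted_norm:
  assumes x: "x \<in> {-1..1}" and s: "s * x = \<bar>x\<bar>" "\<bar>s\<bar> = 1"
  shows "poly_int ([:1, -s:] * (legendre_kernel m x * legendre_kernel m x)) \<le> 10 * real m"
proof (cases m)
  case 0
  thus ?thesis by (simp add: legendre_kernel_def)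
next
  case (Suc k)
  define K where "K = legendre_kernel m x"
  define X where "X = [:x, -1:]"
  define a where "a = poly (legendre k) x"
  have K_eq: "K = legendre_kernel k x + smult a (legendre k)"
    by (simp add: K_def Suc legendre_kernel_Suc a_def)
  have deg: "degree (X * legendre_kernel k x) < m"
  proof (cases k)
    case 0
    thus ?thesis by (simp add: legendre_kernel_def Suc)
  next
    case (Suc j)
    have "degree (X * legendre_kernel k x) \<le> degree X + degree (legendre_kernel k x)"
      by (rule degree_mult_le)
    also have "\<dots> \<le> 1 + (k - 1)"
      using degree_legendre_kernel[of k x] by (simp add: X_def)
    finally show ?thesis using Suc \<open>m = Suc k\<close> by simp
  qed
  have "poly_int (X * legendre_kernel k x * K) = 0"
    unfolding K_def legendre_kernel_reproducing[OF deg] by (simp add: X_def)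
  moreover have "X * K * K = X * legendre_kernel k x * K + smult a (X * K * legendre k)"
    by (subst (2) K_eq) (simp add: algebra_simps)
  ultimately have XKK: "poly_int (X * K * K) = a * poly_int (X * K * legendre k)"
    by simp
  have "(poly_int (X * K * K))\<^sup>2 \<le> a\<^sup>2 * (poly_int ((X * K) * (X * K)) * poly_int (legendre k * legendre k))"
    unfolding XKK power_mult_distrib by (intro mult_left_mono poly_int_Cauchy_Schwarz) auto
  also have "\<dots> \<le> (2 * real m) * (16 * (real m + 1) * 1)"
    using legendre_bound[OF x, of k] legendre_kernel_moment[OF x, of m]
    by (intro mult_mono) (auto simp: a_def Suc legendre_orthonormal X_def K_def intro: poly_int_nonneg)
  also have "\<dots> \<le> (8 * real m)\<^sup>2" by (simp add: Suc power2_eq_square algebra_simps)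
  finally have "\<bar>poly_int (X * K * K)\<bar> \<le> \<bar>8 * real m\<bar>"
    by (simp only: abs_le_square_iff)
  hence "s * poly_int (X * K * K) \<le> 8 * real m"
    using s(2) by (auto simp: abs_if split: if_splits)
  moreover have "[:1, -s:] * (K * K) = smult (1 - \<bar>x\<bar>) (K * K) + smult s (X * K * K)"
    unfolding s(1)[symmetric] X_def by (simp add: poly_eq_poly_eq_iff[symmetric] fun_eq_iff algebra_simps)
  moreover have "(1 - \<bar>x\<bar>) * poly_int (K * K) \<le> 2 * real m"
    using legendre_kernel_diagonal_interior_le[OF x] by (simp add: K_def legendre_kernel_norm)
  ultimately have "poly_int ([:1, -s:] * (K * K)) \<le> 10 * real m"
    by (simp only: poly_int_add poly_int_smult)
  thus ?thesis by (simp only: K_def)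
qed

text \<open>
  Cauchy--Schwarz with the weight \<open>1 - s y + 1 / m\<close>, which is small near the endpoint closest to \<open>x\<close>,
  where the kernel concentrates. The summand \<open>1 / m\<close> makes the reciprocal of the weight integrable,
  at the cost \<open>K(x,x) / m \<le> m\<close>.
\<close>

lemma legendre_Lebesgue_function_le:
  assumes x: "x \<in> {-1..1}" and m: "m > 0"
  shows "integral {-1..1} (\<lambda>y. \<bar>poly (legendre_kernel m x) y\<bar>) \<le> sqrt (11 * real m * ln (2 * real m + 1))"
proof -
  define K where "K = legendre_kernel m x"
  define s :: real where "s = (if x \<ge> 0 then 1 else -1)"
  have s: "s * x = \<bar>x\<bar>" "\<bar>s\<bar> = 1" by (auto simp: s_def)
  define w where "w y = 1 - s * y + 1 / real m" for y
  have w: "w y > 0" if "y \<in> {-1..1}" for y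
  proof -
    have "s * y \<le> 1" using that by (auto simp: s_def)
    moreover have "1 / real m > 0" using m by simp
    ultimately show ?thesis unfolding w_def by linarith
  qed
  have w0: "w y \<noteq> 0" if "y \<in> {-1..1}" for y using w[OF that] by simp
  have cw: "continuous_on {-1..1} w" unfolding w_def by (intro continuous_intros)
  have "\<bar>integral {-1..1} (\<lambda>y. (\<bar>poly K y\<bar> * sqrt (w y)) * (1 / sqrt (w y)))\<bar>
      \<le> sqrt (integral {-1..1} (\<lambda>y. (\<bar>poly K y\<bar> * sqrt (w y))\<^sup>2))
        * sqrt (integral {-1..1} (\<lambda>y. (1 / sqrt (w y))\<^sup>2))"
    using w0 by (intro integral_abs_le_sqrt continuous_intros cw) auto
  also have "integral {-1..1} (\<lambda>y. (\<bar>poly K y\<bar> * sqrt (w y)) * (1 / sqrt (w y)))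
      = integral {-1..1} (\<lambda>y. \<bar>poly K y\<bar>)"
    using w0 by (intro integral_cong) auto
  also have "integral {-1..1} (\<lambda>y. (\<bar>poly K y\<bar> * sqrt (w y))\<^sup>2)
      = integral {-1..1} (poly ([:1, -s:] * (K * K) + smult (1 / real m) (K * K)))"
    using w by (intro integral_cong) (auto simp: power_mult_distrib less_imp_le w_def power2_eq_square algebra_simps)
  also have "\<dots> = poly_int ([:1, -s:] * (K * K)) + 1 / real m * poly_int (K * K)"
    unfolding poly_int_def[symmetric] by (simp only: poly_int_add poly_int_smult)
  also have "integral {-1..1} (\<lambda>y. (1 / sqrt (w y))\<^sup>2) = integral {-1..1} (\<lambda>y. 1 / w y)"
    using w by (intro integral_cong) (auto simp: power_divide less_imp_le)
  also have "\<dots> = ln (2 * real m + 1)"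
  proof (rule integral_unique)
    have "((\<lambda>y. 1 / w y) has_integral (- s * ln (w 1) - (- s * ln (w (-1))))) {-1..1}"
    proof (rule fundamental_theorem_of_calculus)
      fix y :: real assume y: "y \<in> {-1..1}"
      have "s * s = 1" by (simp add: s_def)
      hence "((\<lambda>y. - s * ln (w y)) has_real_derivative 1 / w y) (at y)"
        unfolding w_def using w[OF y] m
        by (auto intro!: derivative_eq_intros simp: w_def divide_simps)
      thus "((\<lambda>y. - s * ln (w y)) has_vector_derivative 1 / w y) (at y within {-1..1})"
        by (simp add: has_real_derivative_iff_has_vector_derivative[symmetric] has_field_derivative_at_within)
    qed simp
    moreover have "- s * ln (w 1) - (- s * ln (w (-1))) = ln (2 + 1 / real m) - ln (1 / real m)"
      by (simp add: s_def w_def)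
    moreover have "\<dots> = ln ((2 + 1 / real m) / (1 / real m))" 
      using m by (intro ln_divide_pos[symmetric]) (auto simp: add_pos_pos)
    moreover have "(2 + 1 / real m) / (1 / real m) = 2 * real m + 1" using m by (simp add: field_simps)
    ultimately show "((\<lambda>y. 1 / w y) has_integral ln (2 * real m + 1)) {-1..1}" by simp
  qed
  finally have "integral {-1..1} (\<lambda>y. \<bar>poly K y\<bar>)
      \<le> sqrt (poly_int ([:1, -s:] * (K * K)) + 1 / real m * poly_int (K * K)) * sqrt (ln (2 * real m + 1))"
    by simp
  also have "\<dots> \<le> sqrt (11 * real m) * sqrt (ln (2 * real m + 1))"
  proof (intro mult_right_mono real_sqrt_le_mono)
    have "1 / real m * poly_int (K * K) \<le> 1 / real m * real m ^ 2"
      unfolding K_def legendre_kernel_norm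
      by (intro mult_left_mono legendre_kernel_diagonal_le x) auto
    thus "poly_int ([:1, -s:] * (K * K)) + 1 / real m * poly_int (K * K) \<le> 11 * real m"
      using legendre_kernel_weighted_norm[OF x s, of m] m by (simp add: K_def power2_eq_square)
  qed (use m in auto)
  finally show ?thesis by (simp add: K_def real_sqrt_mult)
qed

section \<open>Polynomial projections in weighted spaces\<close>

text \<open>
  If \<open>Q\<close> is the projection of \<open>h\<close> onto the polynomials of degree less than \<open>m\<close> in \<open>L\<^sup>2\<close> with weight \<open>\<omega>\<close>,
  then its supremum is bounded by that of \<open>h\<close> times a constant multiple of \<open>(m ln (2m + 1))\<^sup>1\<^sup>/\<^sup>2\<close>.
\<close>

theorem weighted_projection_bound:
  fixes \<omega> :: "real \<Rightarrow> real"
  assumes lip: "\<And>x y. x \<in> {-1..1} \<Longrightarrow> y \<in> {-1..1} \<Longrightarrow> \<bar>\<omega> x - \<omega> y\<bar> \<le> L * \<bar>x - y\<bar>"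
    and low: "a > 0" "\<And>x. x \<in> {-1..1} \<Longrightarrow> a \<le> \<omega> x"
    and up: "\<And>x. x \<in> {-1..1} \<Longrightarrow> \<omega> x \<le> b"
    and m: "m > 0"
    and Q: "degree Q < m"
    and h: "continuous_on {-1..1} h" "\<And>x. x \<in> {-1..1} \<Longrightarrow> \<bar>h x\<bar> \<le> \<epsilon>"
    and orth: "\<And>p. degree p < m \<Longrightarrow> integral {-1..1} (\<lambda>y. (h y - poly Q y) * \<omega> y * poly p y) = 0"
    and x: "x \<in> {-1..1}"
  shows "\<bar>poly Q x\<bar> \<le> (8 * L * sqrt (b / a) + 4 * b) / a * \<epsilon> * sqrt (real m * ln (2 * real m + 1))"
proof -
  have L0: "L \<ge> 0" using lip[of 0 1] by simp
  have e0: "\<epsilon> \<ge> 0" using h(2)[of 0] by simp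
  have ab: "a \<le> b" using low(2)[of 0] up[of 0] by simp
  have "L-lipschitz_on {-1..1} \<omega>"
    using lip L0 by (auto simp: lipschitz_on_def dist_real_def)
  hence c\<omega>: "continuous_on {-1..1} \<omega>" by (rule lipschitz_on_continuous_on)
  have [simp]: "\<omega> y \<ge> 0" "\<bar>\<omega> y\<bar> = \<omega> y" if "y \<in> {-1..1}" for y using low(1) low(2)[OF that] by auto
  note [continuous_intros] = c\<omega> h(1) continuous_on_poly
  define K where "K = legendre_kernel m x"
  have dK: "degree K < m" using degree_legendre_kernel[of m x] m by (simp add: K_def)

  have norm_Q: "integral {-1..1} (\<lambda>y. (poly Q y)\<^sup>2) \<le> 2 * b / a * \<epsilon>\<^sup>2"
  proof -
    have "0 \<le> integral {-1..1} (\<lambda>y. (h y - poly Q y)\<^sup>2 * \<omega> y)"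
      by (rule integral_nonneg) (auto intro!: integrable_continuous_interval continuous_intros)
    also have "\<dots> = integral {-1..1} (\<lambda>y. (h y)\<^sup>2 * \<omega> y - (poly Q y)\<^sup>2 * \<omega> y
        - 2 * ((h y - poly Q y) * \<omega> y * poly Q y))"
      by (simp add: power2_eq_square algebra_simps)
    also have "\<dots> = integral {-1..1} (\<lambda>y. (h y)\<^sup>2 * \<omega> y)
        - integral {-1..1} (\<lambda>y. (poly Q y)\<^sup>2 * \<omega> y)
        - 2 * integral {-1..1} (\<lambda>y. (h y - poly Q y) * \<omega> y * poly Q y)"
      by (subst integral_diff, (intro integrable_continuous_interval continuous_intros)+,
          subst integral_diff, (intro integrable_continuous_interval continuous_intros)+, simp)
    finally have "integral {-1..1} (\<lambda>y. (poly Q y)\<^sup>2 * \<omega> y) \<le> integral {-1..1} (\<lambda>y. (h y)\<^sup>2 * \<omega> y)"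
      using orth[OF Q] by simp
    also have "\<dots> \<le> integral {-1..1} (\<lambda>y::real. \<epsilon>\<^sup>2 * b)"
    proof (rule integral_le)
      fix y :: real assume y: "y \<in> {-1..1}"
      have "\<bar>h y\<bar>\<^sup>2 \<le> \<epsilon>\<^sup>2" using h(2)[OF y] by (intro power_mono) auto
      thus "(h y)\<^sup>2 * \<omega> y \<le> \<epsilon>\<^sup>2 * b" using up[OF y] y by (intro mult_mono) auto
    qed (intro integrable_continuous_interval continuous_intros)+
    finally have "integral {-1..1} (\<lambda>y. (poly Q y)\<^sup>2 * \<omega> y) \<le> 2 * b * \<epsilon>\<^sup>2" by (simp add: mult_ac)
    moreover have "integral {-1..1} (\<lambda>y. a * (poly Q y)\<^sup>2) \<le> integral {-1..1} (\<lambda>y. (poly Q y)\<^sup>2 * \<omega> y)"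
      using low(2) by (intro integral_le integrable_continuous_interval continuous_intros)
        (auto intro: mult_right_mono simp: mult.commute)
    ultimately show ?thesis using low(1) by (simp add: field_simps)
  qed

  \<comment> \<open>Korous' identity: by orthogonality, \<open>Q\<close> may be replaced by \<open>h\<close> under the weight \<open>\<omega>\<close>.\<close>
  have "\<omega> x * poly Q x = \<omega> x * poly_int (Q * K)"
    unfolding K_def legendre_kernel_reproducing[OF Q] by simp
  also have "\<dots> = integral {-1..1} (\<lambda>y. \<omega> x * (poly Q y * poly K y))"
    by (simp add: poly_int_def poly_mult[abs_def])
  also have "\<dots> = integral {-1..1} (\<lambda>y. poly Q y * ((\<omega> x - \<omega> y) * poly K y)
      + (h y * \<omega> y) * poly K y - (h y - poly Q y) * \<omega> y * poly K y)"
    by (simp add: algebra_simps)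
  also have "\<dots> = integral {-1..1} (\<lambda>y. poly Q y * ((\<omega> x - \<omega> y) * poly K y))
      + integral {-1..1} (\<lambda>y. (h y * \<omega> y) * poly K y)
      - integral {-1..1} (\<lambda>y. (h y - poly Q y) * \<omega> y * poly K y)"
    by (subst integral_diff, (intro integrable_continuous_interval continuous_intros)+,
        subst integral_add, (intro integrable_continuous_interval continuous_intros)+, simp)
  finally have rep: "\<omega> x * poly Q x = integral {-1..1} (\<lambda>y. poly Q y * ((\<omega> x - \<omega> y) * poly K y))
      + integral {-1..1} (\<lambda>y. (h y * \<omega> y) * poly K y)"
    using orth[OF dK] by simp

  let ?S = "sqrt (real m * ln (2 * real m + 1))"
  have lnm: "ln (2 * real m + 1) \<ge> 1"
  proof -
    have "exp 1 \<le> 2 * real m + 1" using exp_le m by simp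
    thus ?thesis by (subst ln_ge_iff) auto
  qed
  have S: "sqrt (real m + 1) \<le> sqrt 2 * ?S"
  proof -
    have "real m * 1 \<le> real m * ln (2 * real m + 1)" using lnm by (intro mult_left_mono) auto
    moreover have "real m \<ge> 1" using m by simp
    ultimately have "real m + 1 \<le> 2 * (real m * ln (2 * real m + 1))" by linarith
    thus ?thesis by (simp flip: real_sqrt_mult)
  qed

  have "\<bar>integral {-1..1} (\<lambda>y. poly Q y * ((\<omega> x - \<omega> y) * poly K y))\<bar>
      \<le> sqrt (integral {-1..1} (\<lambda>y. (poly Q y)\<^sup>2)) * sqrt (integral {-1..1} (\<lambda>y. ((\<omega> x - \<omega> y) * poly K y)\<^sup>2))"
    by (intro integral_abs_le_sqrt continuous_intros)
  also have "\<dots> \<le> sqrt (2 * b / a * \<epsilon>\<^sup>2) * sqrt (L\<^sup>2 * (16 * (real m + 1)))"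
  proof (intro mult_mono real_sqrt_le_mono norm_Q)
    have "integral {-1..1} (\<lambda>y. ((\<omega> x - \<omega> y) * poly K y)\<^sup>2)
        \<le> poly_int (smult (L\<^sup>2) (([:x, -1:] * K) * ([:x, -1:] * K)))"
      unfolding poly_int_def
    proof (rule integral_le)
      fix y :: real assume y: "y \<in> {-1..1}"
      have "\<bar>\<omega> x - \<omega> y\<bar>\<^sup>2 \<le> (L * \<bar>x - y\<bar>)\<^sup>2" using lip[OF x y] by (intro power_mono) auto
      hence "\<bar>\<omega> x - \<omega> y\<bar>\<^sup>2 * (poly K y)\<^sup>2 \<le> (L * \<bar>x - y\<bar>)\<^sup>2 * (poly K y)\<^sup>2"
        by (intro mult_right_mono) auto
      thus "((\<omega> x - \<omega> y) * poly K y)\<^sup>2 \<le> poly (smult (L\<^sup>2) (([:x, -1:] * K) * ([:x, -1:] * K))) y"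
        by (simp add: power_mult_distrib) (simp add: power2_eq_square algebra_simps)
    qed (intro integrable_continuous_interval continuous_intros)+
    also have "\<dots> \<le> L\<^sup>2 * (16 * (real m + 1))"
      unfolding poly_int_smult K_def by (intro mult_left_mono legendre_kernel_moment x) auto
    finally show "integral {-1..1} (\<lambda>y. ((\<omega> x - \<omega> y) * poly K y)\<^sup>2) \<le> L\<^sup>2 * (16 * (real m + 1))" .
  qed (use low(1) ab in \<open>auto intro!: integral_nonneg integrable_continuous_interval continuous_intros\<close>)
  also have "\<dots> = 4 * L * \<epsilon> * sqrt 2 * sqrt (b / a) * sqrt (real m + 1)"
    unfolding real_sqrt_mult real_sqrt_divide using L0 e0 by simp
  also have "\<dots> \<le> 4 * L * \<epsilon> * sqrt 2 * sqrt (b / a) * (sqrt 2 * ?S)"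
    using L0 e0 low(1) ab by (intro mult_left_mono S) auto
  also have "\<dots> = 8 * L * sqrt (b / a) * \<epsilon> * ?S"
    by simp
  finally have I1: "\<bar>integral {-1..1} (\<lambda>y. poly Q y * ((\<omega> x - \<omega> y) * poly K y))\<bar>
      \<le> 8 * L * sqrt (b / a) * \<epsilon> * ?S" .

  have "\<bar>integral {-1..1} (\<lambda>y. (h y * \<omega> y) * poly K y)\<bar>
      \<le> integral {-1..1} (\<lambda>y. \<epsilon> * b * \<bar>poly K y\<bar>)"
    unfolding real_norm_def[symmetric]
  proof (rule integral_norm_bound_integral)
    fix y :: real assume y: "y \<in> {-1..1}"
    show "norm (h y * \<omega> y * poly K y) \<le> \<epsilon> * b * norm (poly K y)"
      using h(2)[OF y] up[OF y] y e0 low(1) ab by (auto simp: abs_mult intro!: mult_mono)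
  qed (intro integrable_continuous_interval continuous_intros)+
  also have "\<dots> \<le> \<epsilon> * b * sqrt (11 * real m * ln (2 * real m + 1))"
    using legendre_Lebesgue_function_le[OF x m] e0 low(1) ab by (simp add: K_def mult_left_mono)
  also have "\<dots> = \<epsilon> * b * (sqrt 11 * ?S)"
    by (simp add: real_sqrt_mult)
  also have "\<dots> \<le> \<epsilon> * b * (4 * ?S)"
    using e0 low(1) ab lnm by (intro mult_left_mono mult_right_mono real_le_lsqrt) (auto intro: real_le_lsqrt)
  finally have I2: "\<bar>integral {-1..1} (\<lambda>y. (h y * \<omega> y) * poly K y)\<bar> \<le> 4 * b * \<epsilon> * ?S"
    by (simp add: mult_ac)

  have "a * \<bar>poly Q x\<bar> \<le> \<omega> x * \<bar>poly Q x\<bar>" using low(2)[OF x] by (intro mult_right_mono) auto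
  also have "\<dots> = \<bar>\<omega> x * poly Q x\<bar>" using x by (simp add: abs_mult)
  also have "\<dots> \<le> 8 * L * sqrt (b / a) * \<epsilon> * ?S + 4 * b * \<epsilon> * ?S"
    unfolding rep using I1 I2 by linarith
  finally have "\<bar>poly Q x\<bar> \<le> (8 * L * sqrt (b / a) * \<epsilon> * ?S + 4 * b * \<epsilon> * ?S) / a"
    using low(1) by (simp add: field_simps)
  thus ?thesis by (simp add: algebra_simps add_divide_distrib)
qed

section \<open>Polynomial approximation of Hoelder continuous functions\<close>

fun chebyshev :: "nat \<Rightarrow> real poly" where
  "chebyshev 0 = 1"
| "chebyshev (Suc 0) = [:0, 1:]"
| "chebyshev (Suc (Suc n)) = [:0, 2:] * chebyshev (Suc n) - chebyshev n"

lemma poly_chebyshev_cos: "poly (chebyshev n) (cos \<theta>) = cos (real n * \<theta>)"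
proof (induction n rule: chebyshev.induct)
  case (3 n)
  have "cos (real (Suc (Suc n)) * \<theta>) + cos (real n * \<theta>) = 2 * cos \<theta> * cos (real (Suc n) * \<theta>)"
    by (simp add: cos_plus_cos algebra_simps add_divide_distrib)
  thus ?case using 3 by simp
qed auto

lemma degree_chebyshev: "degree (chebyshev n) \<le> n"
proof (induction n rule: chebyshev.induct)
  case (3 n)
  have "degree ([:0, 2:] * chebyshev (Suc n)) \<le> 1 + degree (chebyshev (Suc n))"
    by (rule order_trans[OF degree_mult_le]) simp
  thus ?case using 3 by (auto intro!: degree_diff_le)
qed auto

text \<open>
  Averaging a trigonometric polynomial of degree less than \<open>M\<close> over \<open>M\<close> equispaced nodes yields its
  constant term.
\<close>

lemma sum_cos_equispaced:
  fixes k :: int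
  assumes k: "\<bar>k\<bar> < int M" and s: "s = 1 \<or> s = -1"
  shows "(\<Sum>j<M. cos (of_int k * (\<theta> - s * (2 * pi * real j / real M)))) = (if k = 0 then real M else 0)"
proof (cases "k = 0")
  case False
  have M: "M > 0" using k by auto
  define a where "a = - (s * of_int k * (2 * pi / real M))"
  have ne: "cis a \<noteq> 1"
  proof
    assume "cis a = 1"
    hence "cos a = 1" by (simp add: complex_eq_iff)
    then obtain i :: int where "a = of_int i * 2 * pi" by (auto simp: cos_one_2pi_int)
    hence "- (s * of_int k) * pi = (of_int i * real M) * pi" using M by (simp add: a_def field_simps)
    hence "- (s * of_int k) = of_int i * real M" unfolding mult_right_cancel[OF pi_neq_zero] .
    hence "of_int (- k) = (of_int (i * int M) :: real) \<or> of_int k = (of_int (i * int M) :: real)"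
      using s by auto
    hence "- k = i * int M \<or> k = i * int M" by (simp only: of_int_eq_iff)
    hence "int M dvd k" by (metis dvd_triv_right dvd_minus_iff)
    thus False using k False by (metis abs_of_nat dvd_imp_le_int not_le)
  qed
  have "cis a ^ M = cis (real M * a)" by (simp add: Complex.DeMoivre)
  also have "real M * a = 2 * pi * of_int (if s = 1 then - k else k)"
    using M s by (auto simp: a_def)
  also have "cis \<dots> = 1" by (rule cis_multiple_2pi) simp
  finally have "(\<Sum>j<M. cis a ^ j) = 0" using ne by (simp add: sum_gp_strict)
  hence "0 = Re (cis (of_int k * \<theta>) * (\<Sum>j<M. cis a ^ j))" by simp
  also have "\<dots> = (\<Sum>j<M. Re (cis (of_int k * \<theta> + real j * a)))"
    by (simp only: sum_distrib_left Re_sum Complex.DeMoivre cis_mult)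
  also have "\<dots> = (\<Sum>j<M. cos (of_int k * (\<theta> - s * (2 * pi * real j / real M))))"
    by (intro sum.cong refl) (simp add: a_def algebra_simps)
  finally show ?thesis using False by simp
qed simp

lemma cos_diff_square_le:
  fixes s t \<theta> :: real
  assumes "s = 1 \<or> s = -1"
  shows "(cos t - cos \<theta>)\<^sup>2 \<le> 2 * (1 - cos (\<theta> - s * t))"
proof -
  have *: "(cos t - cos \<theta>)\<^sup>2 \<le> 2 * (1 - cos (\<theta> - t))" for t :: real and \<theta> :: real
  proof -
    have "(cos t - cos \<theta>)\<^sup>2 \<le> (cos t - cos \<theta>)\<^sup>2 + (sin t - sin \<theta>)\<^sup>2" by simp
    also have "\<dots> = ((cos t)\<^sup>2 + (sin t)\<^sup>2) + ((cos \<theta>)\<^sup>2 + (sin \<theta>)\<^sup>2) - 2 * cos (\<theta> - t)"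
      by (simp only: cos_diff power2_diff) (simp add: algebra_simps)
    finally show ?thesis by simp
  qed
  show ?thesis using *[of t \<theta>] *[of "-t" \<theta>] assms by auto
qed

text \<open>
  A theorem of Jackson type. The function \<open>F (cos \<theta>)\<close> is convolved with the Fejer--Korovkin kernel
  \<open>D(u) = \<bar>\<Sum>\<^sub>k b\<^sub>k e\<^sup>i\<^sup>k\<^sup>u\<bar>\<^sup>2\<close>, where \<open>b\<^sub>k = sin (\<pi> k / N)\<close>, with equispaced nodes in place of the integral,
  which is exact in the relevant degrees. The kernel is nonnegative and its mean of \<open>1 - cos u\<close>, relative to
  that of 1, is \<open>1 - cos (\<pi> / N) = O(N\<^sup>-\<^sup>2)\<close>. The inequality \<open>t\<^sup>\<alpha> \<le> 1 + t\<^sup>2\<close>, with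
  \<open>t = N \<bar>cos \<tau> - cos \<theta>\<bar>\<close>, turns this second moment into the bound for a Hoelder function.
\<close>

theorem holder_polynomial_approximation:
  fixes F :: "real \<Rightarrow> real"
  assumes \<alpha>: "0 \<le> \<alpha>" "\<alpha> \<le> 2" and N: "N \<ge> 2"
    and holder: "\<And>x y. x \<in> {-1..1} \<Longrightarrow> y \<in> {-1..1} \<Longrightarrow> \<bar>F x - F y\<bar> \<le> H * \<bar>x - y\<bar> powr \<alpha>"
  obtains P where "degree P < N"
    and "\<And>x. x \<in> {-1..1} \<Longrightarrow> \<bar>F x - poly P x\<bar> \<le> 11 * H * real N powr (- \<alpha>)"
proof -
  have H0: "H \<ge> 0" using holder[of 0 1] by (simp add: order_trans[OF abs_ge_zero])
  define b where "b k = sin (pi * real k / real N)" for k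
  define B where "B = (\<Sum>k<N. (b k)\<^sup>2)"
  define M where "M = N + 1"
  define t where "t j = 2 * pi * real j / real M" for j
  define D where "D u = (\<Sum>k<N. \<Sum>l<N. b k * b l * cos (of_int (int k - int l) * u))" for u
  have M: "M > 0" "real M > 0" by (auto simp: M_def)
  have B: "B > 0"
  proof -
    have "0 < (b 1)\<^sup>2" using N sin_gt_zero[of "pi / N"] by (simp add: b_def divide_less_eq)
    also have "\<dots> \<le> B" unfolding B_def by (rule member_le_sum) (use N in auto)
    finally show ?thesis .
  qed
  have D0: "D u \<ge> 0" for u
  proof -
    have "D u = (\<Sum>k<N. b k * cos (real k * u))\<^sup>2 + (\<Sum>k<N. b k * sin (real k * u))\<^sup>2"
      unfolding D_def power2_eq_square sum_product sum.distrib[symmetric]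
      by (intro sum.cong refl) (simp add: cos_diff left_diff_distrib algebra_simps)
    thus ?thesis by simp
  qed
  have bN: "b N = 0" "b 0 = 0" using N by (auto simp: b_def)
  \<comment> \<open>The sequence \<open>b\<close> vanishes at 0 and \<open>N\<close>, and
    \<open>b (k + 1) + b (k - 1) = 2 cos (\<pi> / N) b k\<close>.\<close>
  have BB: "(\<Sum>k<N. b k * b (Suc k)) = cos (pi / N) * B"
  proof -
    have "cos (pi / N) * B = (\<Sum>k<N. b k * (cos (pi / N) * b k))"
      by (simp add: B_def sum_distrib_left power2_eq_square mult_ac)
    also have "\<dots> = (\<Sum>k<N. b k * ((b (Suc k) + sin (pi * real k / N - pi / N)) / 2))"
      by (intro sum.cong refl) (simp add: b_def sin_add sin_diff algebra_simps add_divide_distrib)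
    also have "\<dots> = (\<Sum>k<N. b k * b (Suc k)) / 2 + (\<Sum>k<N. b k * sin (pi * real k / N - pi / N)) / 2"
      by (simp add: sum_divide_distrib algebra_simps add_divide_distrib sum.distrib)
    also have "(\<Sum>k<N. b k * sin (pi * real k / N - pi / N)) = (\<Sum>k<Suc N. b k * sin (pi * real k / N - pi / N))"
      by (simp add: bN)
    also have "\<dots> = (\<Sum>k<N. b (Suc k) * sin (pi * real (Suc k) / N - pi / N))"
      by (subst sum.lessThan_Suc_shift) (simp add: bN)
    also have "\<dots> = (\<Sum>k<N. b k * b (Suc k))"
      by (intro sum.cong refl) (simp add: b_def algebra_simps add_divide_distrib)
    finally show ?thesis by simp
  qed

  have avg: "(\<Sum>j<M. D (\<theta> - s * t j)) = M * B"
    and avg_cos: "(\<Sum>j<M. cos (\<theta> - s * t j) * D (\<theta> - s * t j)) = M * (cos (pi / N) * B)"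
    if s: "s = 1 \<or> s = -1" for s \<theta>
  proof -
    have c: "(\<Sum>j<M. cos (of_int i * (\<theta> - s * t j))) = (if i = 0 then real M else 0)"
      if "\<bar>i\<bar> \<le> int N" for i
      unfolding t_def by (rule sum_cos_equispaced[OF _ s]) (use that in \<open>simp add: M_def\<close>)
    have swap: "(\<Sum>j<M. \<Sum>k<N. \<Sum>l<N. g j k l) = (\<Sum>k<N. \<Sum>l<N. \<Sum>j<M. g j k l)"
      for g :: "nat \<Rightarrow> nat \<Rightarrow> nat \<Rightarrow> real"
      by (rule trans[OF sum.swap], rule sum.cong[OF refl], rule sum.swap)
    have "(\<Sum>j<M. D (\<theta> - s * t j))
        = (\<Sum>k<N. \<Sum>l<N. b k * b l * (\<Sum>j<M. cos (of_int (int k - int l) * (\<theta> - s * t j))))"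
      unfolding D_def sum_distrib_left by (rule swap)
    also have "\<dots> = (\<Sum>k<N. \<Sum>l<N. if l = k then real M * (b k)\<^sup>2 else 0)"
      by (intro sum.cong refl) (subst c; auto simp: power2_eq_square)
    also have "\<dots> = M * B"
      by (simp add: B_def sum_distrib_left)
    finally show "(\<Sum>j<M. D (\<theta> - s * t j)) = M * B" .

    have cc: "cos u * cos (of_int i * u) = (cos (of_int (i + 1) * u) + cos (of_int (i - 1) * u)) / 2"
      for i :: int and u :: real
      by (simp add: cos_diff cos_add distrib_right left_diff_distrib)
    have "(\<Sum>j<M. cos (\<theta> - s * t j) * D (\<theta> - s * t j))
        = (\<Sum>j<M. \<Sum>k<N. \<Sum>l<N. b k * b l * ((cos (of_int (int k - int l + 1) * (\<theta> - s * t j))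
             + cos (of_int (int k - int l - 1) * (\<theta> - s * t j))) / 2))"
      unfolding D_def sum_distrib_left cc[symmetric]
      by (intro sum.cong refl) (simp only: mult_ac)
    also have "\<dots> = (\<Sum>k<N. \<Sum>l<N. b k * b l * (\<Sum>j<M. (cos (of_int (int k - int l + 1) * (\<theta> - s * t j))
             + cos (of_int (int k - int l - 1) * (\<theta> - s * t j))) / 2))"
      unfolding sum_distrib_left by (rule swap)
    also have "\<dots> = (\<Sum>k<N. \<Sum>l<N. b k * b l * (((if l = Suc k then real M else 0) + (if k = Suc l then real M else 0)) / 2))"
    proof (intro sum.cong refl arg_cong2[where f = "(*)"])
      fix k l assume "k \<in> {..<N}" "l \<in> {..<N}"
      thus "(\<Sum>j<M. (cos (of_int (int k - int l + 1) * (\<theta> - s * t j))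
             + cos (of_int (int k - int l - 1) * (\<theta> - s * t j))) / 2)
          = ((if l = Suc k then real M else 0) + (if k = Suc l then real M else 0)) / 2"
        unfolding sum_divide_distrib[symmetric] sum.distrib
        by (subst c, simp, subst c, auto)
    qed
    also have "\<dots> = (\<Sum>k<N. \<Sum>l<N. if l = Suc k then real M * (b k * b (Suc k)) else 0) / 2
        + (\<Sum>k<N. \<Sum>l<N. if k = Suc l then real M * (b l * b (Suc l)) else 0) / 2"
      unfolding sum_divide_distrib sum.distrib[symmetric] by (intro sum.cong refl) auto
    also have "(\<Sum>k<N. \<Sum>l<N. if k = Suc l then real M * (b l * b (Suc l)) else 0)
        = (\<Sum>k<N. \<Sum>l<N. if l = Suc k then real M * (b k * b (Suc k)) else 0)"
      by (rule sum.swap)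
    finally have *: "(\<Sum>j<M. cos (\<theta> - s * t j) * D (\<theta> - s * t j))
        = (\<Sum>k<N. \<Sum>l<N. if l = Suc k then real M * (b k * b (Suc k)) else 0)"
      by (simp only: field_sum_of_halves)
    have "(\<Sum>l<N. if l = Suc k then real M * (b k * b (Suc k)) else 0) = real M * (b k * b (Suc k))"
      if "k < N" for k
    proof -
      have "Suc k < N \<or> b (Suc k) = 0" using that bN(1) by (cases "Suc k = N") auto
      thus ?thesis by auto
    qed
    hence "(\<Sum>j<M. cos (\<theta> - s * t j) * D (\<theta> - s * t j)) = (\<Sum>k<N. real M * (b k * b (Suc k)))"
      unfolding * by (intro sum.cong refl) simp
    thus "(\<Sum>j<M. cos (\<theta> - s * t j) * D (\<theta> - s * t j)) = M * (cos (pi / N) * B)"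
      by (simp only: sum_distrib_left[symmetric] BB)
  qed

  \<comment> \<open>Averaging the kernel over \<open>\<theta> - t\<close> and \<open>\<theta> + t\<close> leaves only cosines of multiples of \<open>\<theta>\<close>, which makes
    the approximation a polynomial in \<open>cos \<theta>\<close>.\<close>
  define P where "P = (\<Sum>j<M. \<Sum>k<N. \<Sum>l<N. smult (F (cos (t j)) * (b k * b l * cos (of_int (int k - int l) * t j)) / (M * B))
      (chebyshev (nat \<bar>int k - int l\<bar>)))"
  have P: "poly P (cos \<theta>) = (\<Sum>j<M. F (cos (t j)) * (D (\<theta> - 1 * t j) + D (\<theta> - (-1) * t j))) / (2 * M * B)" for \<theta>
  proof -
    have cheb: "poly (chebyshev (nat \<bar>i\<bar>)) (cos \<theta>) = cos (of_int i * \<theta>)" for i :: int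
      by (cases "i \<ge> 0") (auto simp: poly_chebyshev_cos)
    have cp: "cos (i * (\<theta> - 1 * u)) + cos (i * (\<theta> - (-1) * u)) = 2 * cos (i * u) * cos (i * \<theta>)"
      for i u :: real
      by (simp add: right_diff_distrib distrib_left cos_add cos_diff)
    have DD: "D (\<theta> - 1 * t j) + D (\<theta> - (-1) * t j)
        = 2 * (\<Sum>k<N. \<Sum>l<N. b k * b l * cos (of_int (int k - int l) * t j) * cos (of_int (int k - int l) * \<theta>))" for j
      unfolding D_def sum.distrib[symmetric] sum_distrib_left
      by (simp only: distrib_left[symmetric] cp) (simp only: mult_ac)
    show ?thesis unfolding DD P_def
      by (simp add: poly_sum cheb sum_distrib_left sum_divide_distrib mult_ac del: of_int_diff)
  qed
  have degP: "degree P < N"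
  proof -
    have "degree P \<le> N - 1" unfolding P_def
      by (intro degree_sum_le order_trans[OF degree_smult_le] order_trans[OF degree_chebyshev]) auto
    thus ?thesis using N by simp
  qed

  have key: "\<bar>F (cos \<tau>) - F (cos \<theta>)\<bar> \<le> H * real N powr (-\<alpha>) * (1 + real N ^ 2 * (2 * (1 - cos (\<theta> - s * \<tau>))))"
    if s: "s = 1 \<or> s = -1" for s \<tau> \<theta>
  proof -
    define \<delta> where "\<delta> = \<bar>cos \<tau> - cos \<theta>\<bar>"
    have "(real N * \<delta>) powr \<alpha> \<le> 1 + (real N * \<delta>)\<^sup>2"
    proof (cases "real N * \<delta> \<le> 1")
      case True
      have "(real N * \<delta>) powr \<alpha> \<le> 1" using True \<alpha> by (intro powr_le1) (auto simp: \<delta>_def)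
      thus ?thesis using zero_le_power2[of "real N * \<delta>"] by linarith
    next
      case False
      hence "(real N * \<delta>) powr \<alpha> \<le> (real N * \<delta>) powr 2" using \<alpha> by (intro powr_mono) auto
      also have "\<dots> = (real N * \<delta>)\<^sup>2" using False by (simp add: powr_numeral)
      finally show ?thesis by simp
    qed
    also have "(real N * \<delta>)\<^sup>2 \<le> real N ^ 2 * (2 * (1 - cos (\<theta> - s * \<tau>)))"
      unfolding power_mult_distrib \<delta>_def power2_abs
      by (intro mult_left_mono cos_diff_square_le s) auto
    finally have *: "(real N * \<delta>) powr \<alpha> \<le> 1 + real N ^ 2 * (2 * (1 - cos (\<theta> - s * \<tau>)))" by simp
    have "\<bar>F (cos \<tau>) - F (cos \<theta>)\<bar> \<le> H * \<delta> powr \<alpha>"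
      unfolding \<delta>_def by (intro holder) auto
    also have "\<delta> powr \<alpha> = real N powr (-\<alpha>) * (real N * \<delta>) powr \<alpha>"
      using N by (simp add: powr_mult \<delta>_def powr_minus field_simps)
    also have "H * \<dots> \<le> H * (real N powr (-\<alpha>) * (1 + real N ^ 2 * (2 * (1 - cos (\<theta> - s * \<tau>)))))"
      using H0 * by (intro mult_left_mono) auto
    finally show ?thesis by (simp add: mult_ac)
  qed

  have half: "\<bar>\<Sum>j<M. (F (cos (t j)) - F (cos \<theta>)) * D (\<theta> - s * t j)\<bar> \<le> 11 * H * real N powr (-\<alpha>) * (M * B)"
    if s: "s = 1 \<or> s = -1" for s \<theta>
  proof -
    let ?u = "\<lambda>j. \<theta> - s * t j"
    have "\<bar>\<Sum>j<M. (F (cos (t j)) - F (cos \<theta>)) * D (?u j)\<bar>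
        \<le> (\<Sum>j<M. \<bar>F (cos (t j)) - F (cos \<theta>)\<bar> * D (?u j))"
      by (rule order_trans[OF sum_abs]) (simp add: abs_mult D0)
    also have "\<dots> \<le> (\<Sum>j<M. H * real N powr (-\<alpha>) * (1 + real N ^ 2 * (2 * (1 - cos (?u j)))) * D (?u j))"
      by (intro sum_mono mult_right_mono key s D0)
    also have "\<dots> = H * real N powr (-\<alpha>) * ((1 + 2 * real N ^ 2) * (\<Sum>j<M. D (?u j))
        - 2 * real N ^ 2 * (\<Sum>j<M. cos (?u j) * D (?u j)))"
      by (simp add: sum_distrib_left sum_subtractf algebra_simps sum.distrib)
    also have "\<dots> = H * real N powr (-\<alpha>) * ((1 + 2 * real N ^ 2 * (1 - cos (pi / N))) * (M * B))"
      unfolding avg[OF s] avg_cos[OF s] by (simp add: algebra_simps)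
    also have "\<dots> \<le> H * real N powr (-\<alpha>) * (11 * (M * B))"
    proof (intro mult_left_mono mult_right_mono)
      have "(2 * sin (pi / (2 * N)))\<^sup>2 \<le> (2 * (pi / (2 * N)))\<^sup>2"
        using N sin_x_le_x[of "pi / (2 * N)"] sin_gt_zero[of "pi / (2 * N)"]
        by (intro power_mono mult_left_mono) (auto intro!: sin_ge_zero simp: divide_le_eq)
      moreover have "2 * (1 - cos (pi / N)) = (2 * sin (pi / (2 * N)))\<^sup>2"
        using cos_double_sin[of "pi / (2 * N)"] by (simp add: power2_eq_square)
      ultimately have "2 * (1 - cos (pi / N)) \<le> pi ^ 2 / real N ^ 2" by (simp add: power_divide)
      hence "real N ^ 2 * (2 * (1 - cos (pi / N))) \<le> pi ^ 2" using N by (simp add: field_simps)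
      moreover have "pi ^ 2 \<le> (3.1416 :: real) ^ 2" using pi_approx by (intro power_mono) auto
      moreover have "(3.1416 :: real) ^ 2 \<le> 10" by (simp add: power2_eq_square)
      moreover have "2 * real N ^ 2 * (1 - cos (pi / N)) = real N ^ 2 * (2 * (1 - cos (pi / N)))" by simp
      ultimately show "1 + 2 * real N ^ 2 * (1 - cos (pi / N)) \<le> 11" by linarith
    qed (use M B H0 in auto)
    finally show ?thesis by (simp add: mult_ac)
  qed

  show ?thesis
  proof (rule that[OF degP])
    fix x :: real assume x: "x \<in> {-1..1}"
    define \<theta> where "\<theta> = arccos x"
    have x_eq: "x = cos \<theta>" using x by (simp add: \<theta>_def)
    define A where "A s = (\<Sum>j<M. (F (cos (t j)) - F (cos \<theta>)) * D (\<theta> - s * t j))" for s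
    have "A s = (\<Sum>j<M. F (cos (t j)) * D (\<theta> - s * t j)) - F (cos \<theta>) * (M * B)"
      if "s = 1 \<or> s = -1" for s
      unfolding A_def by (simp add: left_diff_distrib sum_subtractf avg[OF that] flip: sum_distrib_left)
    note A = this[of 1] this[of "-1"]
    have "2 * M * B * poly P x = (\<Sum>j<M. F (cos (t j)) * (D (\<theta> - 1 * t j) + D (\<theta> - (-1) * t j)))"
      unfolding x_eq P using M B by simp
    also have "\<dots> = (\<Sum>j<M. F (cos (t j)) * D (\<theta> - 1 * t j)) + (\<Sum>j<M. F (cos (t j)) * D (\<theta> - (-1) * t j))"
      by (simp only: distrib_left sum.distrib)
    finally have "A 1 + A (-1) = 2 * M * B * poly P x - 2 * M * B * F x"
      using A x_eq by simp
    hence "2 * M * B * (poly P x - F x) = A 1 + A (-1)" by (simp add: algebra_simps)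
    hence "\<bar>2 * M * B * (poly P x - F x)\<bar> \<le> 2 * (11 * H * real N powr (-\<alpha>) * (M * B))"
      using half[of 1 \<theta>] half[of "-1" \<theta>] unfolding A_def by linarith
    hence "2 * M * B * \<bar>F x - poly P x\<bar> \<le> 2 * M * B * (11 * H * real N powr (-\<alpha>))"
      using M B by (simp add: abs_mult abs_minus_commute mult_ac)
    thus "\<bar>F x - poly P x\<bar> \<le> 11 * H * real N powr (-\<alpha>)"
      using M B by (simp add: mult_le_cancel_left)
  qed
qed

section \<open>Uniform convergence of weighted projections\<close>

lemma holder_continuous_on:
  fixes F :: "real \<Rightarrow> real"
  assumes \<alpha>: "\<alpha> > 0" and holder: "\<And>x y. x \<in> S \<Longrightarrow> y \<in> S \<Longrightarrow> \<bar>F x - F y\<bar> \<le> H * \<bar>x - y\<bar> powr \<alpha>"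
  shows "continuous_on S F"
  unfolding continuous_on_def
proof
  fix x assume x: "x \<in> S"
  have "((\<lambda>y. H * \<bar>y - x\<bar> powr \<alpha>) \<longlongrightarrow> H * \<bar>x - x\<bar> powr \<alpha>) (at x within S)"
    using \<alpha> by (intro tendsto_intros) auto
  hence "((\<lambda>y. H * \<bar>y - x\<bar> powr \<alpha>) \<longlongrightarrow> 0) (at x within S)" by simp
  hence "((\<lambda>y. F y - F x) \<longlongrightarrow> 0) (at x within S)"
    by (rule Lim_null_comparison[rotated]) (auto simp: eventually_at_filter holder x)
  thus "(F \<longlongrightarrow> F x) (at x within S)" by (rule LIM_zero_cancel)
qed

text \<open>
  The quantity \<open>m\<^sup>1\<^sup>/\<^sup>2\<^sup>-\<^sup>\<alpha> (ln (2m + 1))\<^sup>1\<^sup>/\<^sup>2\<close>: the approximation error times the growth of the projections.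
\<close>

definition rate :: "real \<Rightarrow> nat \<Rightarrow> real" where
  "rate \<alpha> m = real m powr (- \<alpha>) * sqrt (real m * ln (2 * real m + 1))"

lemma rate_tendsto_0:
  assumes "\<alpha> > 1 / 2"
  shows "rate \<alpha> \<longlonglongrightarrow> 0"
  unfolding rate_def using assms by real_asymp

theorem weighted_projection_converges:
  fixes \<omega> F :: "real \<Rightarrow> real"
  assumes lip: "\<And>x y. x \<in> {-1..1} \<Longrightarrow> y \<in> {-1..1} \<Longrightarrow> \<bar>\<omega> x - \<omega> y\<bar> \<le> L * \<bar>x - y\<bar>"
    and low: "a > 0" "\<And>x. x \<in> {-1..1} \<Longrightarrow> a \<le> \<omega> x"
    and up: "\<And>x. x \<in> {-1..1} \<Longrightarrow> \<omega> x \<le> b"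
    and \<alpha>: "0 < \<alpha>" "\<alpha> \<le> 2"
    and holder: "\<And>x y. x \<in> {-1..1} \<Longrightarrow> y \<in> {-1..1} \<Longrightarrow> \<bar>F x - F y\<bar> \<le> H * \<bar>x - y\<bar> powr \<alpha>"
  shows "\<exists>C\<ge>0. \<forall>m\<ge>2. \<forall>Q. degree Q < m \<longrightarrow>
           (\<forall>p. degree p < m \<longrightarrow> integral {-1..1} (\<lambda>y. (F y - poly Q y) * \<omega> y * poly p y) = 0) \<longrightarrow>
           (\<forall>x\<in>{-1..1}. \<bar>F x - poly Q x\<bar> \<le> C * rate \<alpha> m)"
proof -
  have H0: "H \<ge> 0" using holder[of 0 1] by (simp add: order_trans[OF abs_ge_zero])
  have L0: "L \<ge> 0" using lip[of 0 1] by simp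
  have ab: "a \<le> b" using low(2)[of 0] up[of 0] by simp
  have cF: "continuous_on {-1..1} F" by (rule holder_continuous_on[OF \<alpha>(1) holder])
  define C where "C = (8 * L * sqrt (b / a) + 4 * b) / a"
  have C0: "C \<ge> 0" using L0 low(1) ab by (simp add: C_def)
  have "\<bar>F x - poly Q x\<bar> \<le> 11 * H * (1 + C) * rate \<alpha> m"
    if m: "m \<ge> 2" and Q: "degree Q < m" and x: "x \<in> {-1..1}"
      and orth: "\<And>p. degree p < m \<Longrightarrow> integral {-1..1} (\<lambda>y. (F y - poly Q y) * \<omega> y * poly p y) = 0"
    for m Q and x :: real
  proof -
    define \<epsilon> where "\<epsilon> = 11 * H * real m powr (-\<alpha>)"
    define S where "S = sqrt (real m * ln (2 * real m + 1))"
    obtain P where P: "degree P < m" "\<And>x. x \<in> {-1..1} \<Longrightarrow> \<bar>F x - poly P x\<bar> \<le> \<epsilon>"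
      using holder_polynomial_approximation[of \<alpha> m F H] \<alpha> m holder unfolding \<epsilon>_def by auto
    have "\<bar>poly (Q - P) x\<bar> \<le> (8 * L * sqrt (b / a) + 4 * b) / a * \<epsilon> * sqrt (real m * ln (2 * real m + 1))"
    proof (rule weighted_projection_bound[where h = "\<lambda>y. F y - poly P y", OF lip low up])
      show "degree (Q - P) < m" using Q P(1) by (rule degree_diff_less)
      show "continuous_on {-1..1} (\<lambda>y. F y - poly P y)" by (intro continuous_intros cF)
      fix p :: "real poly" assume "degree p < m"
      thus "integral {-1..1} (\<lambda>y. (F y - poly P y - poly (Q - P) y) * \<omega> y * poly p y) = 0"
        using orth[of p] by simp
    qed (use m x P(2) in auto)
    hence "\<bar>poly (Q - P) x\<bar> \<le> C * \<epsilon> * S" by (simp add: C_def S_def)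
    hence "\<bar>F x - poly Q x\<bar> \<le> \<epsilon> * 1 + C * \<epsilon> * S" using P(2)[OF x] by simp
    also have "\<epsilon> * 1 \<le> \<epsilon> * S"
    proof (rule mult_left_mono)
      have "exp 1 \<le> 2 * real m + 1" using exp_le m by simp
      hence "ln (2 * real m + 1) \<ge> 1" by (subst ln_ge_iff) auto
      hence "1 * 1 \<le> real m * ln (2 * real m + 1)" using m by (intro mult_mono) auto
      thus "1 \<le> S" by (simp add: S_def)
    qed (use H0 in \<open>simp add: \<epsilon>_def\<close>)
    finally show ?thesis
      by (simp add: \<epsilon>_def S_def rate_def algebra_simps)
  qed
  moreover have "11 * H * (1 + C) \<ge> 0" using H0 C0 by simp
  ultimately show ?thesis by blast
qed

section \<open>The change of variable to polynomials\<close>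

lemma holder_mult_lipschitz:
  fixes F G :: "real \<Rightarrow> real"
  assumes \<alpha>: "0 \<le> \<alpha>" "\<alpha> \<le> 1"
    and F: "\<And>x y. x \<in> {-1..1} \<Longrightarrow> y \<in> {-1..1} \<Longrightarrow> \<bar>F x - F y\<bar> \<le> H * \<bar>x - y\<bar> powr \<alpha>"
    and M: "\<And>x. x \<in> {-1..1} \<Longrightarrow> \<bar>F x\<bar> \<le> M"
    and G: "\<And>x y. x \<in> {-1..1} \<Longrightarrow> y \<in> {-1..1} \<Longrightarrow> \<bar>G x - G y\<bar> \<le> L * \<bar>x - y\<bar>"
    and B: "\<And>x. x \<in> {-1..1} \<Longrightarrow> \<bar>G x\<bar> \<le> B"
    and x: "x \<in> {-1..1}" and y: "y \<in> {-1..1}"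
  shows "\<bar>F x * G x - F y * G y\<bar> \<le> (H * B + 2 * M * L) * \<bar>x - y\<bar> powr \<alpha>"
proof (cases "x = y")
  case False
  have L0: "L \<ge> 0" using G[of 0 1] by simp
  have H0: "H \<ge> 0" using F[of 0 1] by simp
  have M0: "M \<ge> 0" using M[of 0] by simp
  have "\<bar>x - y\<bar> = \<bar>x - y\<bar> powr (1 - \<alpha>) * \<bar>x - y\<bar> powr \<alpha>"
    using False by (simp flip: powr_add)
  also have "\<bar>x - y\<bar> powr (1 - \<alpha>) \<le> 2"
  proof (cases "\<bar>x - y\<bar> \<le> 1")
    case True
    hence "\<bar>x - y\<bar> powr (1 - \<alpha>) \<le> 1" using \<alpha> by (intro powr_le1) auto
    thus ?thesis by simp
  next
    case False
    hence "\<bar>x - y\<bar> powr (1 - \<alpha>) \<le> \<bar>x - y\<bar> powr 1" using \<alpha> by (intro powr_mono) auto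
    thus ?thesis using x y by auto
  qed
  finally have d: "\<bar>x - y\<bar> \<le> 2 * \<bar>x - y\<bar> powr \<alpha>" by (simp add: mult_right_mono)
  have "F x * G x - F y * G y = (F x - F y) * G x + F y * (G x - G y)" by (simp add: algebra_simps)
  also have "\<bar>\<dots>\<bar> \<le> \<bar>F x - F y\<bar> * \<bar>G x\<bar> + \<bar>F y\<bar> * \<bar>G x - G y\<bar>"
    by (rule order_trans[OF abs_triangle_ineq]) (simp add: abs_mult)
  also have "\<dots> \<le> (H * \<bar>x - y\<bar> powr \<alpha>) * B + M * (L * (2 * \<bar>x - y\<bar> powr \<alpha>))"
    using H0 M0 L0 by (intro add_mono mult_mono F M B x y order_trans[OF G mult_left_mono[OF d]]) auto
  finally show ?thesis by (simp add: algebra_simps)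
qed simp

text \<open>
  The change of variable \<open>x = X u\<close>, given by \<open>sin (\<pi> x / 2T) = s u\<close>, maps \<open>[-1,1]\<close> onto itself, and
  \<open>\<kappa> u\<close> is \<open>cos (\<pi> x / 2T)\<close>. Since \<open>T > 1\<close>, the constant \<open>s\<close> is less than 1, so that \<open>\<kappa>\<close> is bounded
  below by \<open>\<kappa> 1 > 0\<close>.
\<close>

locale sine_chart =
  fixes T :: real
  assumes T: "T > 1"
begin

definition s :: real where "s = sin (pi / (2 * T))"
definition X :: "real \<Rightarrow> real" where "X u = 2 * T / pi * arcsin (s * u)"
definition \<kappa> :: "real \<Rightarrow> real" where "\<kappa> u = sqrt (1 - (s * u)\<^sup>2)"

lemma half_angle: "0 < pi / (2 * T)" "pi / (2 * T) < pi / 2"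
  using T by (auto simp: field_simps)

lemma s_pos: "s > 0" and s_less_1: "s < 1"
proof -
  show "s > 0" unfolding s_def using half_angle by (intro sin_gt_zero) auto
  have "s < sin (pi / 2)" unfolding s_def using half_angle by (intro sin_monotone_2pi) auto
  thus "s < 1" by simp
qed

lemma mult_s_bounds: assumes "u \<in> {-1..1}" shows "-s \<le> s * u" "s * u \<le> s" "\<bar>s * u\<bar> < 1" "(s * u)\<^sup>2 \<le> s\<^sup>2"
proof -
  have *: "\<bar>s * u\<bar> \<le> s * 1" using assms s_pos by (auto simp: abs_mult intro!: mult_left_mono)
  show "-s \<le> s * u" "s * u \<le> s" "\<bar>s * u\<bar> < 1" using * s_less_1 by (auto simp: abs_le_iff)
  have "\<bar>s * u\<bar>\<^sup>2 \<le> s\<^sup>2" using * by (intro power_mono) auto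
  thus "(s * u)\<^sup>2 \<le> s\<^sup>2" by simp
qed

lemma \<kappa>1_pos: "\<kappa> 1 > 0"
  using s_pos s_less_1 by (simp add: \<kappa>_def abs_square_less_1)

lemma \<kappa>_bounds: assumes "u \<in> {-1..1}" shows "\<kappa> 1 \<le> \<kappa> u" "\<kappa> u \<le> 1" "\<kappa> u > 0"
proof -
  show *: "\<kappa> 1 \<le> \<kappa> u" unfolding \<kappa>_def using mult_s_bounds(4)[OF assms] by simp
  show "\<kappa> u \<le> 1" by (simp add: \<kappa>_def)
  show "\<kappa> u > 0" using * \<kappa>1_pos by simp
qed

lemma X_angle: "pi * X u / (2 * T) = arcsin (s * u)"
  using T by (simp add: X_def)

lemma sin_X: assumes "u \<in> {-1..1}" shows "sin (pi * X u / (2 * T)) = s * u"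
  unfolding X_angle using mult_s_bounds[OF assms] s_less_1 by (intro sin_arcsin) auto

lemma cos_X: assumes "u \<in> {-1..1}" shows "cos (pi * X u / (2 * T)) = \<kappa> u"
  unfolding X_angle \<kappa>_def using mult_s_bounds[OF assms] s_less_1 by (intro cos_arcsin) auto

lemma X_1: "X 1 = 1"
proof -
  have "arcsin (sin (pi / (2 * T))) = pi / (2 * T)" using half_angle by (intro arcsin_sin) auto
  thus ?thesis using T by (simp add: X_def s_def)
qed

lemma X_minus: assumes "u \<in> {-1..1}" shows "X (- u) = - X u"
  using mult_s_bounds[OF assms] s_less_1 by (simp add: X_def arcsin_minus)

lemma X_range: assumes "u \<in> {-1..1}" shows "X u \<in> {-1..1}"
proof -
  have "X u \<le> X 1" "X (-1) \<le> X u"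
    unfolding X_def using assms mult_s_bounds[OF assms] s_less_1 T s_pos
    by (intro mult_left_mono arcsin_le_arcsin; simp)+
  thus ?thesis using X_1 X_minus[of 1] by simp
qed

lemma X_inverse: assumes "x \<in> {-1..1}"
  shows "sin (pi * x / (2 * T)) / s \<in> {-1..1}" "X (sin (pi * x / (2 * T)) / s) = x"
proof -
  have a: "- (pi / (2 * T)) \<le> pi * x / (2 * T)" "pi * x / (2 * T) \<le> pi / (2 * T)"
  proof -
    have "pi * (-1) \<le> pi * x" "pi * x \<le> pi * 1" using assms by (intro mult_left_mono; simp)+
    thus "- (pi / (2 * T)) \<le> pi * x / (2 * T)" "pi * x / (2 * T) \<le> pi / (2 * T)"
      using T by (auto simp: divide_simps)
  qed
  have "sin (pi * x / (2 * T)) \<le> s" "sin (- (pi / (2 * T))) \<le> sin (pi * x / (2 * T))"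
    unfolding s_def using a half_angle by (intro sin_monotone_2pi_le; linarith)+
  thus "sin (pi * x / (2 * T)) / s \<in> {-1..1}" using s_pos by (auto simp: s_def field_simps)
  show "X (sin (pi * x / (2 * T)) / s) = x"
  proof -
    have "arcsin (sin (pi * x / (2 * T))) = pi * x / (2 * T)"
      using a half_angle by (intro arcsin_sin) auto
    thus ?thesis using s_pos T by (simp add: X_def)
  qed
qed

lemma X_deriv: assumes "u \<in> {-1..1}"
  shows "(X has_real_derivative 2 * T * s / pi / \<kappa> u) (at u)"
  unfolding X_def[abs_def] \<kappa>_def using mult_s_bounds(3)[OF assms]
  by (auto intro!: derivative_eq_intros simp: abs_less_iff field_simps)

lemma X_lipschitz:
  assumes "u \<in> {-1..1}" "v \<in> {-1..1}"
  shows "\<bar>X u - X v\<bar> \<le> 2 * T * s / pi / \<kappa> 1 * \<bar>u - v\<bar>"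
proof -
  have "norm (X u - X v) \<le> 2 * T * s / pi / \<kappa> 1 * norm (u - v)"
  proof (rule field_differentiable_bound[of "{-1..1}"])
    fix z :: real assume z: "z \<in> {-1..1}"
    show "(X has_field_derivative 2 * T * s / pi / \<kappa> z) (at z within {-1..1})"
      by (rule has_field_derivative_at_within[OF X_deriv[OF z]])
    show "norm (2 * T * s / pi / \<kappa> z) \<le> 2 * T * s / pi / \<kappa> 1"
      using \<kappa>_bounds[OF z] \<kappa>1_pos T s_pos by (auto simp: abs_mult intro!: divide_left_mono)
  qed (use assms in auto)
  thus ?thesis by simp
qed

lemma \<kappa>_lipschitz:
  assumes u: "u \<in> {-1..1}" and v: "v \<in> {-1..1}"
  shows "\<bar>\<kappa> u - \<kappa> v\<bar> \<le> 1 / \<kappa> 1 * \<bar>u - v\<bar>"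
proof -
  have sq: "(\<kappa> w)\<^sup>2 = 1 - (s * w)\<^sup>2" if "w \<in> {-1..1}" for w
    using \<kappa>_bounds[OF that] unfolding \<kappa>_def by (intro real_sqrt_pow2) simp
  have "(\<kappa> u - \<kappa> v) * (\<kappa> u + \<kappa> v) = s\<^sup>2 * ((v - u) * (v + u))"
    using sq[OF u] sq[OF v] by (simp add: algebra_simps power2_eq_square)
  hence "\<bar>\<kappa> u - \<kappa> v\<bar> * (\<kappa> u + \<kappa> v) = s\<^sup>2 * (\<bar>u - v\<bar> * \<bar>v + u\<bar>)"
  proof -
    assume "(\<kappa> u - \<kappa> v) * (\<kappa> u + \<kappa> v) = s\<^sup>2 * ((v - u) * (v + u))"
    from arg_cong[OF this, of abs] show ?thesis
      using \<kappa>_bounds[OF u] \<kappa>_bounds[OF v] by (simp add: abs_mult abs_minus_commute)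
  qed
  also have "\<dots> \<le> 1 * (\<bar>u - v\<bar> * 2)"
    using u v s_pos s_less_1 by (intro mult_mono) (auto simp: power_le_one)
  finally have "\<bar>\<kappa> u - \<kappa> v\<bar> * (\<kappa> u + \<kappa> v) \<le> 2 * \<bar>u - v\<bar>" by simp
  moreover have "\<bar>\<kappa> u - \<kappa> v\<bar> * (2 * \<kappa> 1) \<le> \<bar>\<kappa> u - \<kappa> v\<bar> * (\<kappa> u + \<kappa> v)"
    using \<kappa>_bounds[OF u] \<kappa>_bounds[OF v] by (intro mult_left_mono) auto
  hence "2 * (\<bar>\<kappa> u - \<kappa> v\<bar> * \<kappa> 1) \<le> \<bar>\<kappa> u - \<kappa> v\<bar> * (\<kappa> u + \<kappa> v)" by (simp only: mult_ac)
  ultimately have "2 * (\<bar>\<kappa> u - \<kappa> v\<bar> * \<kappa> 1) \<le> 2 * \<bar>u - v\<bar>" by (meson order_trans)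
  hence "\<bar>\<kappa> u - \<kappa> v\<bar> * \<kappa> 1 \<le> \<bar>u - v\<bar>" by simp
  thus ?thesis using \<kappa>1_pos by (simp add: field_simps)
qed

lemma inverse_\<kappa>_lipschitz:
  assumes u: "u \<in> {-1..1}" and v: "v \<in> {-1..1}"
  shows "\<bar>1 / \<kappa> u - 1 / \<kappa> v\<bar> \<le> 1 / \<kappa> 1 ^ 3 * \<bar>u - v\<bar>"
proof -
  have "1 / \<kappa> u - 1 / \<kappa> v = (\<kappa> v - \<kappa> u) / (\<kappa> u * \<kappa> v)"
    using \<kappa>_bounds[OF u] \<kappa>_bounds[OF v] by (simp add: field_simps)
  hence "\<bar>1 / \<kappa> u - 1 / \<kappa> v\<bar> = \<bar>\<kappa> u - \<kappa> v\<bar> / (\<kappa> u * \<kappa> v)"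
    using \<kappa>_bounds[OF u] \<kappa>_bounds[OF v] by (simp add: abs_divide abs_mult abs_minus_commute)
  also have "\<dots> \<le> (1 / \<kappa> 1 * \<bar>u - v\<bar>) / (\<kappa> 1 * \<kappa> 1)"
    using \<kappa>_bounds[OF u] \<kappa>_bounds[OF v] \<kappa>1_pos
    by (intro frac_le \<kappa>_lipschitz mult_mono u v) auto
  finally show ?thesis by (simp add: power3_eq_cube)
qed

lemma integral_X:
  fixes g :: "real \<Rightarrow> real"
  assumes "continuous_on {-1..1} g"
  shows "integral {-1..1} g = 2 * T * s / pi * integral {-1..1} (\<lambda>u. g (X u) / \<kappa> u)"
proof -
  have "((\<lambda>u. (2 * T * s / pi / \<kappa> u) *\<^sub>R g (X u)) has_integral integral {X (-1)..X 1} g) {-1..1}"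
  proof (rule has_integral_substitution[where c = "-1" and d = 1])
    show "X (-1) \<le> X 1" using X_1 X_minus[of 1] by simp
    show "X ` {-1..1} \<subseteq> {-1..1}" using X_range by blast
    show "(X has_real_derivative 2 * T * s / pi / \<kappa> u) (at u within {-1..1})" if "u \<in> {-1..1}" for u
      by (rule has_field_derivative_at_within[OF X_deriv[OF that]])
  qed (use assms in simp_all)
  hence "integral {-1..1} g = integral {-1..1} (\<lambda>u. 2 * T * s / pi * (g (X u) / \<kappa> u))"
    using X_1 X_minus[of 1] by (simp add: integral_unique)
  thus ?thesis unfolding integral_mult_right .
qed

text \<open>
  In the variable \<open>u\<close>, the function \<open>cos (\<pi> k x / T)\<close> is the polynomial \<open>cos_poly k\<close>, as
  \<open>cos (\<pi> x / T) = 1 - 2 s\<^sup>2 u\<^sup>2\<close>; and \<open>sin (\<pi> k x / T)\<close> is \<open>\<kappa> u\<close> times the polynomial \<open>sin_poly k\<close>. The latter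
  comes from differentiating \<open>T\<^sub>k(cos \<theta>) = cos (k \<theta>)\<close>, with \<open>T\<^sub>k\<close> the Chebyshev polynomial; it is 0
  for \<open>k = 0\<close>, where the division by \<open>k\<close> gives 0.
\<close>

definition cos_poly :: "nat \<Rightarrow> real poly" where
  "cos_poly k = pcompose (chebyshev k) [:1, 0, - 2 * s\<^sup>2:]"

definition sin_poly :: "nat \<Rightarrow> real poly" where
  "sin_poly k = smult (2 * s / real k) ([:0, 1:] * pcompose (pderiv (chebyshev k)) [:1, 0, - 2 * s\<^sup>2:])"

lemma degree_quadratic: "degree [:1, 0, - 2 * s\<^sup>2:] = 2"
  using s_pos by simp

lemma degree_cos_poly: "degree (cos_poly k) \<le> 2 * k"
  unfolding cos_poly_def degree_pcompose degree_quadratic using degree_chebyshev[of k] by simp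

lemma degree_sin_poly: "degree (sin_poly k) \<le> 2 * k - 1"
proof (cases "k = 0")
  case False
  have "degree (sin_poly k) \<le> degree [:0, 1 :: real:] + degree (pcompose (pderiv (chebyshev k)) [:1, 0, - 2 * s\<^sup>2:])"
    unfolding sin_poly_def by (intro order_trans[OF degree_smult_le] degree_mult_le)
  also have "\<dots> \<le> 1 + 2 * (k - 1)"
    unfolding degree_pcompose degree_quadratic degree_pderiv using degree_chebyshev[of k] by simp
  finally show ?thesis using False by simp
qed (simp add: sin_poly_def)

lemma quadratic_X:
  assumes "u \<in> {-1..1}"
  shows "poly [:1, 0, - 2 * s\<^sup>2:] u = cos (pi * X u / T)"
proof -
  have "cos (2 * (pi * X u / (2 * T))) = 1 - 2 * (s * u)\<^sup>2"
    unfolding cos_double_sin sin_X[OF assms] ..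
  moreover have "2 * (pi * X u / (2 * T)) = pi * X u / T" by simp
  ultimately show ?thesis by (simp add: power2_eq_square algebra_simps)
qed

lemma poly_cos_poly:
  assumes "u \<in> {-1..1}"
  shows "poly (cos_poly k) u = cos (real k * (pi * X u / T))"
  unfolding cos_poly_def poly_pcompose quadratic_X[OF assms] by (rule poly_chebyshev_cos)

lemma sin_chebyshev: "real k * sin (real k * \<theta>) = sin \<theta> * poly (pderiv (chebyshev k)) (cos \<theta>)"
proof -
  have "((\<lambda>\<theta>. poly (chebyshev k) (cos \<theta>)) has_real_derivative
          poly (pderiv (chebyshev k)) (cos \<theta>) * (- sin \<theta>)) (at \<theta>)"
    by (rule DERIV_chain2[OF poly_DERIV]) (auto intro!: derivative_eq_intros)
  moreover have "((\<lambda>\<theta>. poly (chebyshev k) (cos \<theta>)) has_real_derivative - sin (real k * \<theta>) * real k) (at \<theta>)"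
    unfolding poly_chebyshev_cos by (auto intro!: derivative_eq_intros)
  ultimately show ?thesis by (auto dest: DERIV_unique simp: algebra_simps)
qed

lemma poly_sin_poly:
  assumes "u \<in> {-1..1}"
  shows "\<kappa> u * poly (sin_poly k) u = sin (real k * (pi * X u / T))"
proof (cases "k = 0")
  case False
  define \<theta> where "\<theta> = pi * X u / T"
  define p where "p = poly (pderiv (chebyshev k)) (cos \<theta>)"
  have "sin \<theta> = sin (2 * (pi * X u / (2 * T)))" by (simp add: \<theta>_def)
  also have "\<dots> = 2 * (s * u) * \<kappa> u"
    unfolding sin_double sin_X[OF assms] cos_X[OF assms] ..
  finally have "real k * sin (real k * \<theta>) = 2 * (s * u) * \<kappa> u * p"
    by (simp only: sin_chebyshev p_def)
  also have "\<dots> = real k * (\<kappa> u * (2 * s / real k * (u * p)))"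
  proof -
    have "a * (b * (c / a * e)) = c * b * e" if "a \<noteq> 0" for a b c e :: real using that by simp
    from this[of "real k" "\<kappa> u" "2 * s" "u * p"] show ?thesis using False by (simp only: mult_ac of_nat_eq_0_iff simp_thms)
  qed
  also have "2 * s / real k * (u * p) = poly (sin_poly k) u"
    unfolding sin_poly_def poly_smult poly_mult poly_pcompose quadratic_X[OF assms] p_def \<theta>_def
    by (simp only: poly_pCons poly_0 mult_zero_right add_0_left add_0_right mult_1_right)
  finally show ?thesis using False unfolding \<theta>_def by (simp only: mult_left_cancel of_nat_eq_0_iff simp_thms)
qed (simp add: sin_poly_def)

text \<open>
  Orthogonality to the trigonometric functions of degree at most \<open>n\<close> passes to products with even
  powers of \<open>sin (\<pi> x / 2T)\<close> of total degree at most \<open>n\<close>, because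
  \<open>2 sin\<^sup>2 (\<theta> / 2) = 1 - cos \<theta>\<close> and multiplication by \<open>cos \<theta>\<close> shifts the frequency by one.
\<close>

lemma orthogonal_powers:
  fixes d :: "real \<Rightarrow> real"
  assumes d: "continuous_on {-1..1} d"
    and co: "\<And>k. k \<le> n \<Longrightarrow> integral {-1..1} (\<lambda>x. d x * cos (real k * (pi * x / T))) = 0"
    and si: "\<And>k. k \<le> n \<Longrightarrow> integral {-1..1} (\<lambda>x. d x * sin (real k * (pi * x / T))) = 0"
  shows "j + k \<le> n \<Longrightarrow> integral {-1..1} (\<lambda>x. d x * (sin (pi * x / (2 * T)) ^ (2 * j) * cos (real k * (pi * x / T)))) = 0"
    and "j + k \<le> n \<Longrightarrow> integral {-1..1} (\<lambda>x. d x * (sin (pi * x / (2 * T)) ^ (2 * j) * sin (real k * (pi * x / T)))) = 0"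
proof -
  note [continuous_intros] = d
  define J where "J j h = integral {-1..1} (\<lambda>x. d x * (sin (pi * x / (2 * T)) ^ (2 * j) * h (pi * x / T)))"
    for j and h :: "real \<Rightarrow> real"
  have int: "(\<lambda>x. c * (d x * (sin (pi * x / (2 * T)) ^ (2 * j) * g (pi * x / T)))) integrable_on {-1..1}"
    if "continuous_on UNIV g" for c j and g :: "real \<Rightarrow> real"
  proof -
    have "continuous_on {-1..1} (\<lambda>x. g (pi * x / T))"
      by (rule continuous_on_compose2[OF that]) (use T in \<open>auto intro!: continuous_intros\<close>)
    thus ?thesis using T by (intro integrable_continuous_interval continuous_intros) auto
  qed
  have J_Suc: "J (Suc j) g = J j g / 2 - J j h / 4 - J j l / 4"
    if "continuous_on UNIV g" "continuous_on UNIV h" "continuous_on UNIV l"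
      "\<And>\<theta>. h \<theta> + l \<theta> = 2 * cos \<theta> * g \<theta>" for j g h l
  proof -
    have sq: "(sin (pi * x / (2 * T)))\<^sup>2 * g (pi * x / T) = g (pi * x / T) / 2 - h (pi * x / T) / 4 - l (pi * x / T) / 4" for x
    proof -
      have S2: "(sin (pi * x / (2 * T)))\<^sup>2 = (1 - cos (pi * x / T)) / 2"
        using cos_double_sin[of "pi * x / (2 * T)"] by simp
      have h: "h (pi * x / T) = 2 * cos (pi * x / T) * g (pi * x / T) - l (pi * x / T)"
        using that(4)[of "pi * x / T"] by simp
      show ?thesis unfolding S2 h by (simp add: field_simps)
    qed
    have "J (Suc j) g = integral {-1..1} (\<lambda>x. d x * (sin (pi * x / (2 * T)) ^ (2 * j) * ((sin (pi * x / (2 * T)))\<^sup>2 * g (pi * x / T))))"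
      unfolding J_def by (simp add: power2_eq_square mult_ac)
    also have "\<dots> = integral {-1..1} (\<lambda>x. 1 / 2 * (d x * (sin (pi * x / (2 * T)) ^ (2 * j) * g (pi * x / T)))
        - 1 / 4 * (d x * (sin (pi * x / (2 * T)) ^ (2 * j) * h (pi * x / T)))
        - 1 / 4 * (d x * (sin (pi * x / (2 * T)) ^ (2 * j) * l (pi * x / T))))"
      unfolding sq by (simp add: algebra_simps)
    also have "\<dots> = 1 / 2 * J j g - 1 / 4 * J j h - 1 / 4 * J j l"
      unfolding J_def integral_mult_right[symmetric]
      by (simp only: integral_diff integrable_diff int that(1-3))
    finally show ?thesis by simp
  qed
  have C: "j + k \<le> n \<Longrightarrow> J j (\<lambda>\<theta>. cos (real k * \<theta>)) = 0" for j k
  proof (induction j arbitrary: k)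
    case 0
    thus ?case using co[of k] by (simp add: J_def)
  next
    case (Suc j)
    \<comment> \<open>The frequency \<open>\<bar>k - 1\<bar>\<close>.\<close>
    define k' where "k' = (if k = 0 then 1 else k - 1)"
    have k': "cos (real k' * \<theta>) = cos (real k * \<theta> - \<theta>)" for \<theta>
      by (simp add: k'_def of_nat_diff left_diff_distrib)
    have "J (Suc j) (\<lambda>\<theta>. cos (real k * \<theta>))
        = J j (\<lambda>\<theta>. cos (real k * \<theta>)) / 2 - J j (\<lambda>\<theta>. cos (real (Suc k) * \<theta>)) / 4
          - J j (\<lambda>\<theta>. cos (real k' * \<theta>)) / 4"
      unfolding k' by (rule J_Suc) (auto intro!: continuous_intros simp: distrib_right cos_add cos_diff)
    moreover have "j + k' \<le> n" using Suc.prems by (auto simp: k'_def)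
    ultimately show ?case using Suc.IH[of k] Suc.IH[of "Suc k"] Suc.IH[of k'] Suc.prems by simp
  qed
  have S: "j + k \<le> n \<Longrightarrow> J j (\<lambda>\<theta>. sin (real k * \<theta>)) = 0" for j k
  proof (induction j arbitrary: k)
    case 0
    thus ?case using si[of k] by (simp add: J_def)
  next
    case (Suc j)
    show ?case
    proof (cases "k = 0")
      case True
      thus ?thesis by (simp add: J_def)
    next
      case False
      have "J (Suc j) (\<lambda>\<theta>. sin (real k * \<theta>))
          = J j (\<lambda>\<theta>. sin (real k * \<theta>)) / 2 - J j (\<lambda>\<theta>. sin (real (Suc k) * \<theta>)) / 4
            - J j (\<lambda>\<theta>. sin (real (k - 1) * \<theta>)) / 4"
        using False
        by (intro J_Suc) (auto intro!: continuous_intros simp: distrib_right left_diff_distrib of_nat_diff sin_add sin_diff)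
      thus ?thesis using Suc.IH[of k] Suc.IH[of "Suc k"] Suc.IH[of "k - 1"] Suc.prems by simp
    qed
  qed
  show "j + k \<le> n \<Longrightarrow> integral {-1..1} (\<lambda>x. d x * (sin (pi * x / (2 * T)) ^ (2 * j) * cos (real k * (pi * x / T)))) = 0"
    using C[of j k] by (simp add: J_def)
  show "j + k \<le> n \<Longrightarrow> integral {-1..1} (\<lambda>x. d x * (sin (pi * x / (2 * T)) ^ (2 * j) * sin (real k * (pi * x / T)))) = 0"
    using S[of j k] by (simp add: J_def)
qed

text \<open>
  Orthogonality to the powers of \<open>sin (\<pi> x / 2T)\<close>, read in the variable \<open>u\<close>.
\<close>

lemma orthogonal_poly:
  fixes D :: "real \<Rightarrow> real"
  assumes D: "continuous_on {-1..1} D"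
    and orth: "\<And>i. i < m \<Longrightarrow> integral {-1..1} (\<lambda>x. D x * sin (pi * x / (2 * T)) ^ i) = 0"
    and p: "degree p < m"
  shows "integral {-1..1} (\<lambda>u. D (X u) / \<kappa> u * poly p u) = 0"
proof -
  note [continuous_intros] = D
  let ?S = "\<lambda>x. sin (pi * x / (2 * T))"
  let ?G = "\<lambda>x. D x * poly p (?S x / s)"
  have "integral {-1..1} ?G = integral {-1..1} (\<lambda>x. \<Sum>i\<le>degree p. coeff p i / s ^ i * (D x * ?S x ^ i))"
    unfolding poly_altdef by (simp add: sum_distrib_left power_divide mult_ac)
  also have "\<dots> = (\<Sum>i\<le>degree p. coeff p i / s ^ i * integral {-1..1} (\<lambda>x. D x * ?S x ^ i))"
    unfolding integral_mult_right[symmetric]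
    by (rule integral_sum) (use T s_pos in \<open>auto intro!: integrable_continuous_interval continuous_intros\<close>)
  also have "\<dots> = 0" using orth p by simp
  finally have "2 * T * s / pi * integral {-1..1} (\<lambda>u. ?G (X u) / \<kappa> u) = 0"
    by (subst (asm) integral_X) (use T s_pos in \<open>auto intro!: continuous_intros\<close>)
  hence "integral {-1..1} (\<lambda>u. ?G (X u) / \<kappa> u) = 0" using T s_pos by simp
  also have "integral {-1..1} (\<lambda>u. ?G (X u) / \<kappa> u) = integral {-1..1} (\<lambda>u. D (X u) / \<kappa> u * poly p u)"
    by (rule integral_cong) (use s_pos in \<open>simp add: sin_X\<close>)
  finally show ?thesis .
qed

end

section \<open>Fourier extension of real functions\<close>

text \<open>
  For an even or odd function \<open>h\<close> (\<open>\<tau> = 1\<close> or \<open>\<tau> = -1\<close>), testing the even or odd part of \<open>d\<close>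
  (\<open>\<sigma> = 1\<close> or \<open>\<sigma> = -1\<close>) amounts to testing \<open>d\<close> if the parities agree, and gives 0 otherwise.
\<close>

lemma integral_parity:
  fixes d h :: "real \<Rightarrow> real"
  assumes d: "continuous_on {-1..1} d" and h: "continuous_on {-1..1} h"
    and \<tau>: "\<And>x. h (- x) = \<tau> * h x"
  shows "integral {-1..1} (\<lambda>x. (d x + \<sigma> * d (- x)) / 2 * h x)
           = (1 + \<sigma> * \<tau>) / 2 * integral {-1..1} (\<lambda>x. d x * h x)"
proof -
  have d': "continuous_on {-1..1} (\<lambda>x. d (- x))"
    by (rule continuous_on_compose2[OF d]) (auto intro!: continuous_intros)
  have "integral {-1..1} (\<lambda>x. d (- x) * h x) = integral {-1..1} (\<lambda>x. d (- (- x)) * h (- x))"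
    using Henstock_Kurzweil_Integration.integral_reflect_real[of 1 "-1" "\<lambda>x. d (- x) * h x"] by simp
  also have "\<dots> = \<tau> * integral {-1..1} (\<lambda>x. d x * h x)"
    unfolding \<tau> integral_mult_right[symmetric] by (simp add: mult_ac)
  finally have r: "integral {-1..1} (\<lambda>x. d (- x) * h x) = \<tau> * integral {-1..1} (\<lambda>x. d x * h x)" .
  have "integral {-1..1} (\<lambda>x. (d x + \<sigma> * d (- x)) / 2 * h x)
      = integral {-1..1} (\<lambda>x. 1 / 2 * (d x * h x) + \<sigma> / 2 * (d (- x) * h x))"
    by (rule integral_cong) (simp add: field_simps)
  also have "\<dots> = 1 / 2 * integral {-1..1} (\<lambda>x. d x * h x) + \<sigma> / 2 * integral {-1..1} (\<lambda>x. d (- x) * h x)"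
    by (subst integral_add) (auto intro!: integrable_continuous_interval continuous_intros d d' h)
  finally show ?thesis unfolding r by (simp add: field_simps)
qed

context sine_chart
begin

text \<open>
  Here \<open>r\<close> is an arbitrary real trigonometric sum for which \<open>f - r\<close> is orthogonal to all trigonometric
  functions of degree at most \<open>n\<close>. Frequencies range over \<open>-n..n\<close>, redundantly for real functions, to match
  the real and imaginary parts of complex sums. The even part of \<open>f - r\<close> is treated as a projection with
  weight \<open>1 / \<kappa>\<close> onto degrees below \<open>2n + 1\<close>, the odd part, divided by \<open>\<kappa>\<close>, as one with weight \<open>\<kappa>\<close> onto
  degrees below \<open>2n\<close>; orthogonality to the powers of the wrong parity is automatic.
\<close>

theorem real_fourier_extension_rate:
  fixes f :: "real \<Rightarrow> real"
  assumes \<alpha>: "0 < \<alpha>" "\<alpha> \<le> 1"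
    and holder: "\<And>x y. x \<in> {-1..1} \<Longrightarrow> y \<in> {-1..1} \<Longrightarrow> \<bar>f x - f y\<bar> \<le> H * \<bar>x - y\<bar> powr \<alpha>"
  shows "\<exists>C. \<forall>n\<ge>1. \<forall>A B r.
      (\<forall>x. r x = (\<Sum>k=-int n..int n. A k * cos (of_int k * (pi * x / T)) + B k * sin (of_int k * (pi * x / T)))) \<longrightarrow>
      (\<forall>k\<le>n. integral {-1..1} (\<lambda>x. (f x - r x) * cos (real k * (pi * x / T))) = 0 \<and>
             integral {-1..1} (\<lambda>x. (f x - r x) * sin (real k * (pi * x / T))) = 0) \<longrightarrow>
      (\<forall>x\<in>{-1..1}. \<bar>f x - r x\<bar> \<le> C * (rate \<alpha> (2 * n) + rate \<alpha> (2 * n + 1)))"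
proof -
  have H0: "H \<ge> 0" using holder[of 0 1] by (simp add: order_trans[OF abs_ge_zero])
  have cf: "continuous_on {-1..1} f" by (rule holder_continuous_on[OF \<alpha>(1) holder])
  define K where "K = 2 * T * s / pi / \<kappa> 1"
  have K0: "K \<ge> 0" unfolding K_def using T s_pos \<kappa>1_pos by simp

  have holder_X: "\<bar>f (X u) - f (X v)\<bar> \<le> H * K powr \<alpha> * \<bar>u - v\<bar> powr \<alpha>"
    if "u \<in> {-1..1}" "v \<in> {-1..1}" for u v
  proof -
    have "\<bar>f (X u) - f (X v)\<bar> \<le> H * \<bar>X u - X v\<bar> powr \<alpha>"
      by (intro holder X_range that)
    also have "\<dots> \<le> H * (K * \<bar>u - v\<bar>) powr \<alpha>"
      using X_lipschitz[OF that] \<alpha> H0 by (intro mult_left_mono powr_mono2) (auto simp: K_def)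
    finally show ?thesis using K0 by (simp add: powr_mult)
  qed
  have parity: "\<bar>(a + \<sigma> * c) / 2 - (a' + \<sigma> * c') / 2\<bar> \<le> b"
    if "\<sigma> = 1 \<or> \<sigma> = -1" "\<bar>a - a'\<bar> \<le> b" "\<bar>c - c'\<bar> \<le> b" for a a' b c c' \<sigma> :: real
  proof (cases "\<sigma> = 1")
    case True
    show ?thesis unfolding True using that(2,3) by (simp add: abs_le_iff field_simps)
  next
    case False
    with that(1) have \<sigma>: "\<sigma> = -1" by simp
    show ?thesis unfolding \<sigma> using that(2,3) by (simp add: abs_le_iff field_simps)
  qed
  have parity_X: "\<bar>(f (X u) + \<sigma> * f (- X u)) / 2 - (f (X v) + \<sigma> * f (- X v)) / 2\<bar> \<le> H * K powr \<alpha> * \<bar>u - v\<bar> powr \<alpha>"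
    if "u \<in> {-1..1}" "v \<in> {-1..1}" "\<sigma> = 1 \<or> \<sigma> = -1" for u v \<sigma>
  proof -
    have minus: "\<bar>f (- X u) - f (- X v)\<bar> \<le> H * K powr \<alpha> * \<bar>u - v\<bar> powr \<alpha>"
      using holder_X[of "-u" "-v"] X_minus[OF that(1)] X_minus[OF that(2)] that by (simp add: abs_minus_commute)
    show ?thesis by (rule parity[OF that(3) holder_X[OF that(1,2)] minus])
  qed

  have "\<exists>C\<ge>0. \<forall>m\<ge>2. \<forall>Q. degree Q < m \<longrightarrow>
      (\<forall>p. degree p < m \<longrightarrow> integral {-1..1} (\<lambda>u. ((f (X u) + 1 * f (- X u)) / 2 - poly Q u) * (1 / \<kappa> u) * poly p u) = 0) \<longrightarrow>
      (\<forall>u\<in>{-1..1}. \<bar>(f (X u) + 1 * f (- X u)) / 2 - poly Q u\<bar> \<le> C * rate \<alpha> m)"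
  proof (rule weighted_projection_converges[of "\<lambda>u. 1 / \<kappa> u" "1 / \<kappa> 1 ^ 3" 1 "1 / \<kappa> 1" \<alpha>
        "\<lambda>u. (f (X u) + 1 * f (- X u)) / 2" "H * K powr \<alpha>"])
    fix u :: real assume u: "u \<in> {-1..1}"
    show "1 \<le> 1 / \<kappa> u" "1 / \<kappa> u \<le> 1 / \<kappa> 1"
      using \<kappa>_bounds[OF u] \<kappa>1_pos by (auto simp: field_simps)
    fix v :: real assume v: "v \<in> {-1..1}"
    show "\<bar>1 / \<kappa> u - 1 / \<kappa> v\<bar> \<le> 1 / \<kappa> 1 ^ 3 * \<bar>u - v\<bar>" by (rule inverse_\<kappa>_lipschitz[OF u v])
    show "\<bar>(f (X u) + 1 * f (- X u)) / 2 - (f (X v) + 1 * f (- X v)) / 2\<bar> \<le> H * K powr \<alpha> * \<bar>u - v\<bar> powr \<alpha>"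
      by (rule parity_X[OF u v]) simp
  qed (use \<alpha> in auto)
  then obtain Ce where Ce: "Ce \<ge> 0" "\<And>m Q u. m \<ge> 2 \<Longrightarrow> degree Q < m \<Longrightarrow> u \<in> {-1..1} \<Longrightarrow>
      (\<And>p. degree p < m \<Longrightarrow> integral {-1..1} (\<lambda>u. ((f (X u) + 1 * f (- X u)) / 2 - poly Q u) * (1 / \<kappa> u) * poly p u) = 0) \<Longrightarrow>
      \<bar>(f (X u) + 1 * f (- X u)) / 2 - poly Q u\<bar> \<le> Ce * rate \<alpha> m"
    by blast

  define M where "M = \<bar>f 0\<bar> + H"
  have M: "\<bar>f x\<bar> \<le> M" if "x \<in> {-1..1}" for x
  proof -
    have "\<bar>f x - f 0\<bar> \<le> H * \<bar>x - 0\<bar> powr \<alpha>" using that by (intro holder) auto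
    also have "\<dots> \<le> H * 1" using that \<alpha> H0 by (intro mult_left_mono powr_le1) auto
    finally show ?thesis unfolding M_def by linarith
  qed
  have "\<exists>C\<ge>0. \<forall>m\<ge>2. \<forall>Q. degree Q < m \<longrightarrow>
      (\<forall>p. degree p < m \<longrightarrow> integral {-1..1} (\<lambda>u. ((f (X u) + (-1) * f (- X u)) / 2 * (1 / \<kappa> u) - poly Q u) * \<kappa> u * poly p u) = 0) \<longrightarrow>
      (\<forall>u\<in>{-1..1}. \<bar>(f (X u) + (-1) * f (- X u)) / 2 * (1 / \<kappa> u) - poly Q u\<bar> \<le> C * rate \<alpha> m)"
  proof (rule weighted_projection_converges[of \<kappa> "1 / \<kappa> 1" "\<kappa> 1" 1 \<alpha>
        "\<lambda>u. (f (X u) + (-1) * f (- X u)) / 2 * (1 / \<kappa> u)" "H * K powr \<alpha> * (1 / \<kappa> 1) + 2 * M * (1 / \<kappa> 1 ^ 3)"])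
    fix u :: real assume u: "u \<in> {-1..1}"
    show "\<kappa> 1 \<le> \<kappa> u" "\<kappa> u \<le> 1" using \<kappa>_bounds[OF u] by auto
    fix v :: real assume v: "v \<in> {-1..1}"
    show "\<bar>\<kappa> u - \<kappa> v\<bar> \<le> 1 / \<kappa> 1 * \<bar>u - v\<bar>" by (rule \<kappa>_lipschitz[OF u v])
    show "\<bar>(f (X u) + (-1) * f (- X u)) / 2 * (1 / \<kappa> u) - (f (X v) + (-1) * f (- X v)) / 2 * (1 / \<kappa> v)\<bar>
        \<le> (H * K powr \<alpha> * (1 / \<kappa> 1) + 2 * M * (1 / \<kappa> 1 ^ 3)) * \<bar>u - v\<bar> powr \<alpha>"
    proof (rule holder_mult_lipschitz)
      fix w :: real assume w: "w \<in> {-1..1}"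
      show "\<bar>(f (X w) + (-1) * f (- X w)) / 2\<bar> \<le> M"
      proof -
        have "\<bar>f (X w)\<bar> \<le> M" "\<bar>f (- X w)\<bar> \<le> M"
          using M[OF X_range[OF w]] M[of "- X w"] X_range[OF w] by auto
        thus ?thesis by (simp add: abs_le_iff field_simps)
      qed
      show "\<bar>1 / \<kappa> w\<bar> \<le> 1 / \<kappa> 1" using \<kappa>_bounds[OF w] \<kappa>1_pos by (auto simp: field_simps)
      fix z :: real assume z: "z \<in> {-1..1}"
      show "\<bar>1 / \<kappa> w - 1 / \<kappa> z\<bar> \<le> 1 / \<kappa> 1 ^ 3 * \<bar>w - z\<bar>" by (rule inverse_\<kappa>_lipschitz[OF w z])
      show "\<bar>(f (X w) + (-1) * f (- X w)) / 2 - (f (X z) + (-1) * f (- X z)) / 2\<bar>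
          \<le> H * K powr \<alpha> * \<bar>w - z\<bar> powr \<alpha>" by (rule parity_X[OF w z]) simp
    qed (use \<alpha> u v in auto)
  qed (use \<alpha> \<kappa>1_pos in auto)
  then obtain Co where Co: "Co \<ge> 0" "\<And>m Q u. m \<ge> 2 \<Longrightarrow> degree Q < m \<Longrightarrow> u \<in> {-1..1} \<Longrightarrow>
      (\<And>p. degree p < m \<Longrightarrow> integral {-1..1} (\<lambda>u. ((f (X u) + (-1) * f (- X u)) / 2 * (1 / \<kappa> u) - poly Q u) * \<kappa> u * poly p u) = 0) \<Longrightarrow>
      \<bar>(f (X u) + (-1) * f (- X u)) / 2 * (1 / \<kappa> u) - poly Q u\<bar> \<le> Co * rate \<alpha> m"
    by blast

  have "\<bar>f x - r x\<bar> \<le> (Ce + Co) * (rate \<alpha> (2 * n) + rate \<alpha> (2 * n + 1))"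
    if n: "n \<ge> 1" and x: "x \<in> {-1..1}"
      and r: "\<And>x. r x = (\<Sum>k=-int n..int n. A k * cos (of_int k * (pi * x / T)) + B k * sin (of_int k * (pi * x / T)))"
      and co: "\<And>k. k \<le> n \<Longrightarrow> integral {-1..1} (\<lambda>x. (f x - r x) * cos (real k * (pi * x / T))) = 0"
      and si: "\<And>k. k \<le> n \<Longrightarrow> integral {-1..1} (\<lambda>x. (f x - r x) * sin (real k * (pi * x / T))) = 0"
    for n A B r and x :: real
  proof -
    define d where "d x = f x - r x" for x
    have cd: "continuous_on {-1..1} d"
      unfolding d_def r using T by (intro continuous_intros cf) auto
    have cd': "continuous_on {-1..1} (\<lambda>x. d (- x))"
      by (rule continuous_on_compose2[OF cd]) (auto intro!: continuous_intros)
    note co' = co[folded d_def] and si' = si[folded d_def]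
    let ?S = "\<lambda>x. sin (pi * x / (2 * T))"
    let ?C = "\<lambda>x. cos (pi * x / (2 * T))"
    define E where "E x = (\<Sum>k=-int n..int n. A k * cos (of_int k * (pi * x / T)))" for x
    define O' where "O' x = (\<Sum>k=-int n..int n. B k * sin (of_int k * (pi * x / T)))" for x
    have rEO: "r x = E x + O' x" for x by (simp add: r E_def O'_def sum.distrib)
    have E_minus: "E (- x) = E x" and O_minus: "O' (- x) = - O' x" for x
      by (simp_all add: E_def O'_def sum_negf)
    have dE: "(d x + 1 * d (- x)) / 2 = (f x + 1 * f (- x)) / 2 - E x" for x
      by (simp add: d_def rEO E_minus O_minus field_simps)
    have dO: "(d x + (-1) * d (- x)) / 2 = (f x + (-1) * f (- x)) / 2 - O' x" for x
      by (simp add: d_def rEO E_minus O_minus field_simps)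

    define Q where "Q = (\<Sum>k=-int n..int n. smult (A k) (cos_poly (nat \<bar>k\<bar>)))"
    define R where "R = (\<Sum>k=-int n..int n. smult (B k * of_int (sgn k)) (sin_poly (nat \<bar>k\<bar>)))"
    have Q: "poly Q u = E (X u)" if "u \<in> {-1..1}" for u
    proof -
      have cs: "cos (real (nat \<bar>k\<bar>) * \<theta>) = cos (of_int k * \<theta>)" for k :: int and \<theta> :: real
        by (cases "k \<ge> 0") auto
      show ?thesis unfolding Q_def E_def poly_sum poly_smult poly_cos_poly[OF that] cs ..
    qed
    have R: "\<kappa> u * poly R u = O' (X u)" if "u \<in> {-1..1}" for u
    proof -
      have sgn: "of_int (sgn k) * sin (real (nat \<bar>k\<bar>) * \<theta>) = sin (of_int k * \<theta>)" for k :: int and \<theta> :: real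
        by (cases k "0 :: int" rule: linorder_cases) auto
      have "\<kappa> u * poly R u = (\<Sum>k=-int n..int n. B k * (of_int (sgn k) * (\<kappa> u * poly (sin_poly (nat \<bar>k\<bar>)) u)))"
        by (simp add: R_def poly_sum sum_distrib_left mult_ac)
      thus ?thesis unfolding O'_def poly_sin_poly[OF that] sgn .
    qed
    have degQ: "degree Q < 2 * n + 1"
    proof -
      have "degree Q \<le> 2 * n" unfolding Q_def
        by (intro degree_sum_le order_trans[OF degree_smult_le] order_trans[OF degree_cos_poly]) auto
      thus ?thesis by simp
    qed
    have degR: "degree R < 2 * n"
    proof -
      have "degree R \<le> 2 * n - 1" unfolding R_def
        by (intro degree_sum_le order_trans[OF degree_smult_le] order_trans[OF degree_sin_poly]) auto
      thus ?thesis using n by simp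
    qed

    define u where "u = ?S x / s"
    have u: "u \<in> {-1..1}" and Xu: "X u = x" using X_inverse[OF x] by (auto simp: u_def)

    have e: "\<bar>(f (X u) + 1 * f (- X u)) / 2 - poly Q u\<bar> \<le> Ce * rate \<alpha> (2 * n + 1)"
    proof (rule Ce(2)[OF _ degQ u])
      fix p :: "real poly" assume p: "degree p < 2 * n + 1"
      have "integral {-1..1} (\<lambda>u. ((d (X u) + 1 * d (- X u)) / 2) / \<kappa> u * poly p u) = 0"
      proof (rule orthogonal_poly[OF _ _ p, where D = "\<lambda>x. (d x + 1 * d (- x)) / 2"])
        show "continuous_on {-1..1} (\<lambda>x. (d x + 1 * d (- x)) / 2)" by (intro continuous_intros cd cd') auto
        fix i assume i: "i < 2 * n + 1"
        have "integral {-1..1} (\<lambda>x. (d x + 1 * d (- x)) / 2 * ?S x ^ i)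
            = (1 + 1 * (-1) ^ i) / 2 * integral {-1..1} (\<lambda>x. d x * ?S x ^ i)"
          using T by (intro integral_parity cd) (auto intro!: continuous_intros simp: power_minus[of "sin _"])
        also have "\<dots> = 0"
        proof (cases "even i")
          case True
          then obtain j where "i = 2 * j" by blast
          thus ?thesis using orthogonal_powers(1)[OF cd co' si', of n j 0] i by simp
        qed simp
        finally show "integral {-1..1} (\<lambda>x. (d x + 1 * d (- x)) / 2 * ?S x ^ i) = 0" .
      qed
      also have "integral {-1..1} (\<lambda>u. ((d (X u) + 1 * d (- X u)) / 2) / \<kappa> u * poly p u)
          = integral {-1..1} (\<lambda>u. ((f (X u) + 1 * f (- X u)) / 2 - poly Q u) * (1 / \<kappa> u) * poly p u)"
        unfolding dE by (intro integral_cong) (simp add: Q)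
      finally show "integral {-1..1} (\<lambda>u. ((f (X u) + 1 * f (- X u)) / 2 - poly Q u) * (1 / \<kappa> u) * poly p u) = 0" .
    qed (use n in auto)

    have o: "\<bar>(f (X u) + (-1) * f (- X u)) / 2 * (1 / \<kappa> u) - poly R u\<bar> \<le> Co * rate \<alpha> (2 * n)"
    proof (rule Co(2)[OF _ degR u])
      fix p :: "real poly" assume p: "degree p < 2 * n"
      have "integral {-1..1} (\<lambda>u. ((d (X u) + (-1) * d (- X u)) / 2 * ?C (X u)) / \<kappa> u * poly p u) = 0"
      proof (rule orthogonal_poly[OF _ _ p, where D = "\<lambda>x. (d x + (-1) * d (- x)) / 2 * ?C x"])
        show "continuous_on {-1..1} (\<lambda>x. (d x + (-1) * d (- x)) / 2 * ?C x)"
          using T by (intro continuous_intros cd cd') auto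
        fix i assume i: "i < 2 * n"
        have "integral {-1..1} (\<lambda>x. (d x + (-1) * d (- x)) / 2 * (?C x * ?S x ^ i))
            = (1 + (-1) * (-1) ^ i) / 2 * integral {-1..1} (\<lambda>x. d x * (?C x * ?S x ^ i))"
          using T by (intro integral_parity cd) (auto intro!: continuous_intros simp: power_minus[of "sin _"])
        also have "\<dots> = 0"
        proof (cases "odd i")
          case True
          then obtain j where j: "i = 2 * j + 1" by (auto elim: oddE)
          have S2: "sin (real 1 * (pi * x / T)) = 2 * ?S x * ?C x" for x
            using sin_double[of "pi * x / (2 * T)"] by simp
          have "integral {-1..1} (\<lambda>x. d x * (?S x ^ (2 * j) * sin (real 1 * (pi * x / T)))) = 0"
            using orthogonal_powers(2)[OF cd co' si', of n j 1] i j by simp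
          hence "2 * integral {-1..1} (\<lambda>x. d x * (?C x * ?S x ^ i)) = 0"
            unfolding S2 integral_mult_right[symmetric] by (simp add: j mult_ac)
          thus ?thesis by simp
        qed simp
        finally show "integral {-1..1} (\<lambda>x. (d x + (-1) * d (- x)) / 2 * ?C x * ?S x ^ i) = 0"
          by (simp only: mult.assoc)
      qed
      also have "integral {-1..1} (\<lambda>u. ((d (X u) + (-1) * d (- X u)) / 2 * ?C (X u)) / \<kappa> u * poly p u)
          = integral {-1..1} (\<lambda>u. ((f (X u) + (-1) * f (- X u)) / 2 * (1 / \<kappa> u) - poly R u) * \<kappa> u * poly p u)"
      proof (rule integral_cong)
        fix w :: real assume w: "w \<in> {-1..1}"
        have "\<kappa> w \<noteq> 0" using \<kappa>_bounds[OF w] by simp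
        thus "((d (X w) + (-1) * d (- X w)) / 2 * ?C (X w)) / \<kappa> w * poly p w
            = ((f (X w) + (-1) * f (- X w)) / 2 * (1 / \<kappa> w) - poly R w) * \<kappa> w * poly p w"
          unfolding dO cos_X[OF w] R[OF w, symmetric] by (simp add: field_simps)
      qed
      finally show "integral {-1..1} (\<lambda>u. ((f (X u) + (-1) * f (- X u)) / 2 * (1 / \<kappa> u) - poly R u) * \<kappa> u * poly p u) = 0" .
    qed (use n in auto)

    have e': "\<bar>(f x + 1 * f (- x)) / 2 - E x\<bar> \<le> Ce * rate \<alpha> (2 * n + 1)"
      using e unfolding Q[OF u] Xu .
    have "(f x + (-1) * f (- x)) / 2 - O' x
        = \<kappa> u * ((f (X u) + (-1) * f (- X u)) / 2 * (1 / \<kappa> u) - poly R u)"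
    proof -
      define a where "a = (f x + (-1) * f (- x)) / 2"
      show ?thesis
        unfolding Xu a_def[symmetric] using R[OF u] \<kappa>_bounds(3)[OF u] by (simp add: Xu right_diff_distrib)
    qed
    hence "\<bar>(f x + (-1) * f (- x)) / 2 - O' x\<bar>
        = \<kappa> u * \<bar>(f (X u) + (-1) * f (- X u)) / 2 * (1 / \<kappa> u) - poly R u\<bar>"
      using \<kappa>_bounds(3)[OF u] by (simp add: abs_mult)
    also have "\<dots> \<le> 1 * (Co * rate \<alpha> (2 * n))"
      using \<kappa>_bounds[OF u] by (intro mult_mono o) auto
    finally have o': "\<bar>(f x + (-1) * f (- x)) / 2 - O' x\<bar> \<le> Co * rate \<alpha> (2 * n)" by simp
    have "f x - r x = ((f x + 1 * f (- x)) / 2 - E x) + ((f x + (-1) * f (- x)) / 2 - O' x)"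
      by (simp add: rEO field_simps)
    hence "\<bar>f x - r x\<bar> \<le> Ce * rate \<alpha> (2 * n + 1) + Co * rate \<alpha> (2 * n)"
      using e' o' by linarith
    also have "\<dots> \<le> (Ce + Co) * (rate \<alpha> (2 * n) + rate \<alpha> (2 * n + 1))"
    proof -
      have "rate \<alpha> m \<ge> 0" for m by (simp add: rate_def)
      thus ?thesis using Ce(1) Co(1) by (simp add: algebra_simps)
    qed
    finally show ?thesis .
  qed
  thus ?thesis by blast
qed

end

section \<open>Orthogonal projection onto the trigonometric sums\<close>

lemma integral_of_real_complex:
  fixes f :: "real \<Rightarrow> real"
  assumes "f integrable_on S"
  shows "integral S (\<lambda>x. complex_of_real (f x)) = complex_of_real (integral S f)"
  using has_integral_of_real[OF integrable_integral[OF assms]] by (rule integral_unique)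

lemma integral_Re_complex:
  fixes f :: "real \<Rightarrow> complex"
  assumes "f integrable_on S"
  shows "integral S (\<lambda>x. Re (f x)) = Re (integral S f)"
    and "integral S (\<lambda>x. Im (f x)) = Im (integral S f)"
  using has_integral_linear[OF integrable_integral[OF assms] bounded_linear_Re]
    has_integral_linear[OF integrable_integral[OF assms] bounded_linear_Im]
  by (auto simp: o_def integral_unique)

lemma integral_norm_square_eq_0:
  fixes w :: "real \<Rightarrow> complex"
  assumes w: "continuous_on {a..b} w" and "a < b"
    and 0: "integral {a..b} (\<lambda>x. (cmod (w x))\<^sup>2) \<le> 0" and x: "x \<in> {a..b}"
  shows "w x = 0"
proof -
  have c: "continuous_on {a..b} (\<lambda>x. (cmod (w x))\<^sup>2)" by (intro continuous_intros w)
  have "integral {a..b} (\<lambda>x. (cmod (w x))\<^sup>2) \<ge> 0"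
    by (rule integral_nonneg) (auto intro: integrable_continuous_interval c)
  hence "integral {a..b} (\<lambda>x. (cmod (w x))\<^sup>2) = 0" using 0 by simp
  hence "\<forall>x\<in>{a..b}. (cmod (w x))\<^sup>2 = 0"
    by (subst (asm) integral_eq_0_iff) (use \<open>a < b\<close> c in auto)
  thus ?thesis using x by simp
qed

text \<open>
  The coefficients come from Gram--Schmidt orthogonalization, by induction on the number of
  functions; the functions \<open>e k\<close> need not be linearly independent.
\<close>

lemma orthogonal_projection_exists:
  fixes e :: "'i \<Rightarrow> real \<Rightarrow> complex" and f :: "real \<Rightarrow> complex"
  assumes "finite A" and "a < b" and "continuous_on {a..b} f"
    and "\<And>k. k \<in> A \<Longrightarrow> continuous_on {a..b} (e k)"
  shows "\<exists>c. \<forall>j\<in>A. integral {a..b} (\<lambda>x. (f x - (\<Sum>k\<in>A. c k * e k x)) * cnj (e j x)) = 0"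
  using assms
proof (induction A arbitrary: f rule: finite_induct)
  case (insert i A)
  note [continuous_intros] = insert.prems(2) insert.prems(3)[OF insertI1] insert.prems(3)[OF insertI2]
  obtain c where c: "\<forall>j\<in>A. integral {a..b} (\<lambda>x. (f x - (\<Sum>k\<in>A. c k * e k x)) * cnj (e j x)) = 0"
    using insert.IH[of f] insert.prems by auto
  obtain c' where c': "\<forall>j\<in>A. integral {a..b} (\<lambda>x. (e i x - (\<Sum>k\<in>A. c' k * e k x)) * cnj (e j x)) = 0"
    using insert.IH[of "e i"] insert.prems by auto
  define g where "g x = f x - (\<Sum>k\<in>A. c k * e k x)" for x
  define w where "w x = e i x - (\<Sum>k\<in>A. c' k * e k x)" for x
  have cg: "continuous_on {a..b} g" unfolding g_def by (intro continuous_intros) auto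
  have cw: "continuous_on {a..b} w" unfolding w_def by (intro continuous_intros) auto
  note [continuous_intros] = cg cw
  define N where "N = integral {a..b} (\<lambda>x. w x * cnj (w x))"
  define t where "t = integral {a..b} (\<lambda>x. g x * cnj (w x)) / N"
  \<comment> \<open>If \<open>N = 0\<close>, then \<open>t = 0\<close> by division by zero, and \<open>w\<close> vanishes on \<open>[a,b]\<close>.\<close>
  have N: "integral {a..b} (\<lambda>x. g x * cnj (w x)) = t * N"
  proof (cases "N = 0")
    case True
    have "N = complex_of_real (integral {a..b} (\<lambda>x. (cmod (w x))\<^sup>2))"
      unfolding N_def complex_norm_square[symmetric]
      by (intro integral_of_real_complex integrable_continuous_interval continuous_intros)
    hence "w x = 0" if "x \<in> {a..b}" for x
      using integral_norm_square_eq_0[OF cw \<open>a < b\<close> _ that] True by simp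
    hence "integral {a..b} (\<lambda>x. g x * cnj (w x)) = integral {a..b} (\<lambda>x. 0)"
      by (intro integral_cong) auto
    thus ?thesis using True by simp
  qed (simp add: t_def)
  have lin: "integral {a..b} (\<lambda>x. (g x - t * w x) * cnj (h x))
      = integral {a..b} (\<lambda>x. g x * cnj (h x)) - t * integral {a..b} (\<lambda>x. w x * cnj (h x))"
    if "continuous_on {a..b} h" for h
    unfolding integral_mult_right[symmetric] left_diff_distrib mult.assoc
    by (rule integral_diff) (intro integrable_continuous_interval continuous_intros that)+
  have A: "integral {a..b} (\<lambda>x. (g x - t * w x) * cnj (e j x)) = 0" if "j \<in> A" for j
    using lin[of "e j"] c c' that insert.prems(3) by (auto simp: g_def w_def)
  have i: "integral {a..b} (\<lambda>x. (g x - t * w x) * cnj (e i x)) = 0"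
  proof -
    have "integral {a..b} (\<lambda>x. (g x - t * w x) * cnj (e i x))
        = integral {a..b} (\<lambda>x. (g x - t * w x) * cnj (w x)
            + (\<Sum>k\<in>A. cnj (c' k) * ((g x - t * w x) * cnj (e k x))))"
    proof (rule integral_cong)
      fix x
      have "cnj (e i x) = cnj (w x) + (\<Sum>k\<in>A. cnj (c' k) * cnj (e k x))" by (simp add: w_def)
      thus "(g x - t * w x) * cnj (e i x) = (g x - t * w x) * cnj (w x)
          + (\<Sum>k\<in>A. cnj (c' k) * ((g x - t * w x) * cnj (e k x)))"
        by (simp only: distrib_left sum_distrib_left mult.left_commute)
    qed
    also have "\<dots> = integral {a..b} (\<lambda>x. (g x - t * w x) * cnj (w x))
        + (\<Sum>k\<in>A. cnj (c' k) * integral {a..b} (\<lambda>x. (g x - t * w x) * cnj (e k x)))"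
      by (subst integral_add, (intro integrable_continuous_interval continuous_intros; simp)+,
          subst integral_sum[OF insert.hyps(1)], (intro integrable_continuous_interval continuous_intros; simp)+,
          simp only: integral_mult_right)
    also have "\<dots> = 0" using A lin[OF cw] N by (simp add: N_def)
    finally show ?thesis .
  qed
  define d where "d k = (if k = i then t else c k - t * c' k)" for k
  have "f x - (\<Sum>k\<in>insert i A. d k * e k x) = g x - t * w x" for x
  proof -
    have "(\<Sum>k\<in>A. d k * e k x) = (\<Sum>k\<in>A. c k * e k x) - t * (\<Sum>k\<in>A. c' k * e k x)"
      unfolding sum_distrib_left sum_subtractf[symmetric]
      using insert.hyps by (intro sum.cong) (auto simp: d_def algebra_simps)
    thus ?thesis using insert.hyps by (simp add: g_def w_def d_def algebra_simps)
  qed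
  thus ?case using A i by (intro exI[of _ d]) auto
qed simp

lemma L2_norm_continuous:
  assumes "continuous_on {-1..1} g"
  shows "L2_norm g = sqrt (integral {-1..1} (\<lambda>x. (cmod (g x))\<^sup>2))"
proof -
  have c: "continuous_on {-1..1} (\<lambda>x. (cmod (g x))\<^sup>2)" by (intro continuous_intros assms)
  have "set_integrable lebesgue {-1<..<1} (\<lambda>x. (cmod (g x))\<^sup>2)"
    by (rule set_integrable_subset[OF absolutely_integrable_continuous_real[OF c]]) auto
  hence "integrable (lebesgue_on {-1<..<1}) (\<lambda>x. (cmod (g x))\<^sup>2)"
    by (simp add: integrable_restrict_space set_integrable_def)
  hence "(LINT x|lebesgue_on {-1<..<1}. (cmod (g x))\<^sup>2) = integral {-1<..<1} (\<lambda>x. (cmod (g x))\<^sup>2)"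
    by (rule lebesgue_integral_eq_integral) simp
  also have "\<dots> = integral {-1..1} (\<lambda>x. (cmod (g x))\<^sup>2)"
    by (rule integral_open_interval_real[symmetric])
  finally show ?thesis by (simp add: L2_norm_def)
qed

text \<open>
  The elements of \<open>H\<^sub>N\<close>, \<open>N = 2n + 1\<close>, before the restriction to \<open>[-1,1]\<close>.
\<close>

definition trig_sum :: "real \<Rightarrow> nat \<Rightarrow> (int \<Rightarrow> complex) \<Rightarrow> real \<Rightarrow> complex" where
  "trig_sum T n c x = (\<Sum>k=-int n..int n. c k * exp (\<i> * complex_of_real (pi / T * of_int k * x)))"

lemma fourier_space_eq: "fourier_space T (2 * n + 1) = range (\<lambda>c. restrict (trig_sum T n c) {-1..1})"
proof -
  have "int ((2 * n + 1) div 2) = int n" by simp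
  thus ?thesis unfolding fourier_space_def trig_sum_def[abs_def] by auto
qed

lemma continuous_on_trig_sum: "continuous_on A (trig_sum T n c)"
  unfolding trig_sum_def[abs_def] by (intro continuous_intros)

lemma L2_norm_diff_restrict:
  assumes f: "continuous_on {-1..1} f"
  shows "L2_norm (\<lambda>x. f x - restrict (trig_sum T n c) {-1..1} x)
           = sqrt (integral {-1..1} (\<lambda>x. (cmod (f x - trig_sum T n c x))\<^sup>2))"
proof -
  have "continuous_on {-1..1} (\<lambda>x. f x - trig_sum T n c x)"
    by (intro continuous_intros f continuous_on_trig_sum)
  hence "continuous_on {-1..1} (\<lambda>x. f x - restrict (trig_sum T n c) {-1..1} x)"
    by (rule continuous_on_eq) simp
  hence "L2_norm (\<lambda>x. f x - restrict (trig_sum T n c) {-1..1} x)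
      = sqrt (integral {-1..1} (\<lambda>x. (cmod (f x - restrict (trig_sum T n c) {-1..1} x))\<^sup>2))"
    by (rule L2_norm_continuous)
  also have "integral {-1..1} (\<lambda>x. (cmod (f x - restrict (trig_sum T n c) {-1..1} x))\<^sup>2)
      = integral {-1..1} (\<lambda>x. (cmod (f x - trig_sum T n c x))\<^sup>2)"
    by (rule integral_cong) simp
  finally show ?thesis .
qed

text \<open>
  By Pythagoras, a trigonometric sum whose difference to \<open>f\<close> is orthogonal to \<open>H\<^sub>N\<close> is a minimizer,
  and any other minimizer agrees with it on \<open>[-1,1]\<close>. The description by \<open>THE\<close> is therefore proper, and the
  Fourier extension is characterized by orthogonality.
\<close>

lemma fourier_extension_orthogonal:
  assumes f: "continuous_on {-1..1} f"
  obtains c where "fourier_extension T (2 * n + 1) f = restrict (trig_sum T n c) {-1..1}"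
    and "\<And>k. \<bar>k\<bar> \<le> int n \<Longrightarrow> integral {-1..1}
           (\<lambda>x. (f x - trig_sum T n c x) * cnj (exp (\<i> * complex_of_real (pi / T * of_int k * x)))) = 0"
proof -
  let ?e = "\<lambda>(k::int) x. exp (\<i> * complex_of_real (pi / T * of_int k * x))"
  note [continuous_intros] = f continuous_on_trig_sum
  have e: "continuous_on {-1..1} (?e k)" for k by (intro continuous_intros)
  have "\<exists>c. \<forall>j\<in>{-int n..int n}. integral {-1..1}
      (\<lambda>x. (f x - (\<Sum>k\<in>{-int n..int n}. c k * ?e k x)) * cnj (?e j x)) = 0"
    by (rule orthogonal_projection_exists[OF _ _ f e]) simp_all
  then obtain c where "\<forall>j\<in>{-int n..int n}. integral {-1..1}
      (\<lambda>x. (f x - (\<Sum>k\<in>{-int n..int n}. c k * ?e k x)) * cnj (?e j x)) = 0"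
    by blast
  hence c: "integral {-1..1} (\<lambda>x. (f x - trig_sum T n c x) * cnj (?e k x)) = 0" if "\<bar>k\<bar> \<le> int n" for k
    using that by (auto simp: trig_sum_def abs_le_iff)
  define n2 where "n2 g = integral {-1..1} (\<lambda>x. (cmod (g x))\<^sup>2)" for g :: "real \<Rightarrow> complex"
  have pythagoras: "n2 (\<lambda>x. f x - trig_sum T n d x)
      = n2 (\<lambda>x. f x - trig_sum T n c x) + n2 (\<lambda>x. trig_sum T n c x - trig_sum T n d x)" for d
  proof -
    let ?g = "\<lambda>x. f x - trig_sum T n c x" and ?h = "\<lambda>x. trig_sum T n c x - trig_sum T n d x"
    have h: "?h x = (\<Sum>k=-int n..int n. (c k - d k) * ?e k x)" for x
      by (simp add: trig_sum_def left_diff_distrib sum_subtractf)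
    have "integral {-1..1} (\<lambda>x. ?g x * cnj (?h x))
        = integral {-1..1} (\<lambda>x. \<Sum>k=-int n..int n. cnj (c k - d k) * (?g x * cnj (?e k x)))"
      unfolding h by (simp add: sum_distrib_left mult_ac)
    also have "\<dots> = (\<Sum>k=-int n..int n. cnj (c k - d k) * integral {-1..1} (\<lambda>x. ?g x * cnj (?e k x)))"
      unfolding integral_mult_right[symmetric]
      by (rule integral_sum) (simp, intro integrable_continuous_interval continuous_intros)
    also have "\<dots> = 0"
    proof (intro sum.neutral ballI)
      fix k assume "k \<in> {-int n..int n}"
      hence "\<bar>k\<bar> \<le> int n" by auto
      show "cnj (c k - d k) * integral {-1..1} (\<lambda>x. ?g x * cnj (?e k x)) = 0"
        unfolding c[OF \<open>\<bar>k\<bar> \<le> int n\<close>] by (rule mult_zero_right)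
    qed
    finally have orth: "integral {-1..1} (\<lambda>x. ?g x * cnj (?h x)) = 0" .
    have "integral {-1..1} (\<lambda>x. Re (?g x * cnj (?h x))) = Re (integral {-1..1} (\<lambda>x. ?g x * cnj (?h x)))"
      by (rule integral_Re_complex) (intro integrable_continuous_interval continuous_intros)
    hence 0: "integral {-1..1} (\<lambda>x. Re (?g x * cnj (?h x))) = 0" unfolding orth by simp
    have "n2 (\<lambda>x. f x - trig_sum T n d x)
        = integral {-1..1} (\<lambda>x. (cmod (?g x))\<^sup>2 + (cmod (?h x))\<^sup>2 + 2 * Re (?g x * cnj (?h x)))"
      unfolding n2_def
    proof (rule integral_cong)
      fix x
      have "(cmod (a + b))\<^sup>2 = (cmod a)\<^sup>2 + (cmod b)\<^sup>2 + 2 * Re (a * cnj b)" for a b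
        unfolding cmod_power2 by (simp add: power2_eq_square algebra_simps)
      from this[of "?g x" "?h x"] show "(cmod (f x - trig_sum T n d x))\<^sup>2
          = (cmod (?g x))\<^sup>2 + (cmod (?h x))\<^sup>2 + 2 * Re (?g x * cnj (?h x))" by simp
    qed
    also have "\<dots> = n2 ?g + n2 ?h + 2 * integral {-1..1} (\<lambda>x. Re (?g x * cnj (?h x)))"
      unfolding n2_def integral_mult_right[symmetric]
      by (subst integral_add, (intro integrable_continuous_interval continuous_intros)+,
          subst integral_add, (intro integrable_continuous_interval continuous_intros)+, rule refl)
    finally show ?thesis unfolding 0 by simp
  qed
  have nn: "n2 (\<lambda>x. trig_sum T n c x - trig_sum T n d x) \<ge> 0" for d
    unfolding n2_def by (rule integral_nonneg) (auto intro!: integrable_continuous_interval continuous_intros)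
  have min: "L2_norm (\<lambda>x. f x - restrict (trig_sum T n c) {-1..1} x)
      \<le> L2_norm (\<lambda>x. f x - restrict (trig_sum T n d) {-1..1} x)" for d
    unfolding L2_norm_diff_restrict[OF f]
    using pythagoras[of d, unfolded n2_def] nn[of d, unfolded n2_def] by simp
  have "fourier_extension T (2 * n + 1) f = restrict (trig_sum T n c) {-1..1}"
    unfolding fourier_extension_def
  proof (rule the_equality)
    show "restrict (trig_sum T n c) {-1..1} \<in> fourier_space T (2 * n + 1) \<and>
      (\<forall>s\<in>fourier_space T (2 * n + 1). L2_norm (\<lambda>x. f x - restrict (trig_sum T n c) {-1..1} x) \<le> L2_norm (\<lambda>x. f x - s x))"
      unfolding fourier_space_eq using min by blast
  next
    fix r assume r: "r \<in> fourier_space T (2 * n + 1) \<and>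
      (\<forall>s\<in>fourier_space T (2 * n + 1). L2_norm (\<lambda>x. f x - r x) \<le> L2_norm (\<lambda>x. f x - s x))"
    then obtain d where d: "r = restrict (trig_sum T n d) {-1..1}" unfolding fourier_space_eq by blast
    have "L2_norm (\<lambda>x. f x - r x) \<le> L2_norm (\<lambda>x. f x - restrict (trig_sum T n c) {-1..1} x)"
      using r unfolding fourier_space_eq by blast
    hence "n2 (\<lambda>x. f x - trig_sum T n d x) \<le> n2 (\<lambda>x. f x - trig_sum T n c x)"
      unfolding d L2_norm_diff_restrict[OF f] n2_def by simp
    hence le: "integral {-1..1} (\<lambda>x. (cmod (trig_sum T n c x - trig_sum T n d x))\<^sup>2) \<le> 0"
      using pythagoras[of d] by (simp add: n2_def)
    have "trig_sum T n c x - trig_sum T n d x = 0" if "x \<in> {-1..1}" for x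
      by (rule integral_norm_square_eq_0[OF _ _ le that]) (auto intro!: continuous_intros)
    thus "r = restrict (trig_sum T n c) {-1..1}" unfolding d by (auto simp: restrict_def)
  qed
  thus ?thesis using c by (rule that)
qed

section \<open>Uniform convergence of Fourier extensions\<close>

text \<open>
  Nonnegativity needs that the measure is nonzero: the essential supremum over a null space
  is \<open>-\<infinity>\<close>.
\<close>

lemma Linf_norm_bounds:
  assumes g: "continuous_on {-1<..<1} g" and b: "\<And>x. x \<in> {-1<..<1} \<Longrightarrow> cmod (g x) \<le> b"
  shows "0 \<le> Linf_norm g" and "Linf_norm g \<le> ereal b"
proof -
  let ?M = "lebesgue_on {-1<..<1::real}"
  have "g \<in> borel_measurable ?M" using g by (intro continuous_imp_measurable_on_sets_lebesgue) auto
  hence meas: "(\<lambda>x. ereal (cmod (g x))) \<in> borel_measurable ?M" by measurable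
  show "Linf_norm g \<le> ereal b"
    unfolding Linf_norm_def by (rule esssup_I[OF meas]) (auto intro!: AE_I2 b)
  have "emeasure ?M (space ?M) \<noteq> 0" by (simp add: emeasure_restrict_space)
  hence "0 = esssup ?M (\<lambda>x. 0 :: ereal)" by (simp add: esssup_const)
  also have "\<dots> \<le> Linf_norm g" unfolding Linf_norm_def by (rule esssup_mono) auto
  finally show "0 \<le> Linf_norm g" .
qed

theorem theorem3p4:
  fixes T \<alpha> :: real and f :: "real \<Rightarrow> complex"
  assumes "T > 1"
    and "\<alpha> \<in> {0..1}" and "\<alpha> > 1 / 2"
    and "f \<in> holder_space \<alpha>"
  shows "(\<lambda>n::nat. Linf_norm (\<lambda>x. f x - fourier_extension T (2 * n + 1) f x)) \<longlonglongrightarrow> 0"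
proof -
  interpret sine_chart T by unfold_locales (rule assms(1))
  have \<alpha>: "0 < \<alpha>" "\<alpha> \<le> 1" using assms(2,3) by auto
  have cf: "continuous_on {-1..1} f" using assms(4) by (simp add: holder_space_def)
  obtain H where H: "cmod (f x - f y) \<le> H * \<bar>x - y\<bar> powr \<alpha>" if "x \<in> {-1..1}" "y \<in> {-1..1}" for x y
  proof -
    from assms(4) obtain H where "\<And>x y. x \<in> {-1..1} \<Longrightarrow> y \<in> {-1..1} \<Longrightarrow> x \<noteq> y \<Longrightarrow>
        cmod (f x - f y) / \<bar>x - y\<bar> powr \<alpha> \<le> H"
      unfolding holder_space_def bdd_above_def by blast
    hence "cmod (f x - f y) \<le> H * \<bar>x - y\<bar> powr \<alpha>" if "x \<in> {-1..1}" "y \<in> {-1..1}" for x y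
      using that by (cases "x = y") (auto simp: divide_le_eq)
    thus ?thesis by (rule that)
  qed
  have hRe: "\<bar>Re (f x) - Re (f y)\<bar> \<le> H * \<bar>x - y\<bar> powr \<alpha>"
    and hIm: "\<bar>Im (f x) - Im (f y)\<bar> \<le> H * \<bar>x - y\<bar> powr \<alpha>"
    if "x \<in> {-1..1}" "y \<in> {-1..1}" for x y
    using H[OF that] abs_Re_le_cmod[of "f x - f y"] abs_Im_le_cmod[of "f x - f y"] by auto
  obtain C1 where C1: "\<forall>n\<ge>1. \<forall>A B r.
      (\<forall>x. r x = (\<Sum>k=-int n..int n. A k * cos (of_int k * (pi * x / T)) + B k * sin (of_int k * (pi * x / T)))) \<longrightarrow>
      (\<forall>k\<le>n. integral {-1..1} (\<lambda>x. (Re (f x) - r x) * cos (real k * (pi * x / T))) = 0 \<and>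
             integral {-1..1} (\<lambda>x. (Re (f x) - r x) * sin (real k * (pi * x / T))) = 0) \<longrightarrow>
      (\<forall>x\<in>{-1..1}. \<bar>Re (f x) - r x\<bar> \<le> C1 * (rate \<alpha> (2 * n) + rate \<alpha> (2 * n + 1)))"
    by (rule exE[OF real_fourier_extension_rate[OF \<alpha> hRe]]) (assumption | rule that)+
  obtain C2 where C2: "\<forall>n\<ge>1. \<forall>A B r.
      (\<forall>x. r x = (\<Sum>k=-int n..int n. A k * cos (of_int k * (pi * x / T)) + B k * sin (of_int k * (pi * x / T)))) \<longrightarrow>
      (\<forall>k\<le>n. integral {-1..1} (\<lambda>x. (Im (f x) - r x) * cos (real k * (pi * x / T))) = 0 \<and>
             integral {-1..1} (\<lambda>x. (Im (f x) - r x) * sin (real k * (pi * x / T))) = 0) \<longrightarrow>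
      (\<forall>x\<in>{-1..1}. \<bar>Im (f x) - r x\<bar> \<le> C2 * (rate \<alpha> (2 * n) + rate \<alpha> (2 * n + 1)))"
    by (rule exE[OF real_fourier_extension_rate[OF \<alpha> hIm]]) (assumption | rule that)+
  define \<eta> where "\<eta> n = (C1 + C2) * (rate \<alpha> (2 * n) + rate \<alpha> (2 * n + 1))" for n

  have bounds: "0 \<le> Linf_norm (\<lambda>x. f x - fourier_extension T (2 * n + 1) f x) \<and>
      Linf_norm (\<lambda>x. f x - fourier_extension T (2 * n + 1) f x) \<le> ereal (\<eta> n)" if n: "n \<ge> 1" for n
  proof -
    let ?e = "\<lambda>(k::int) x. exp (\<i> * complex_of_real (pi / T * of_int k * x))"
    let ?\<theta> = "\<lambda>x. pi * x / T"
    obtain c where fe: "fourier_extension T (2 * n + 1) f = restrict (trig_sum T n c) {-1..1}"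
      and c: "\<And>k. \<bar>k\<bar> \<le> int n \<Longrightarrow> integral {-1..1} (\<lambda>x. (f x - trig_sum T n c x) * cnj (?e k x)) = 0"
      using fourier_extension_orthogonal[OF cf] by blast
    define d where "d x = f x - trig_sum T n c x" for x
    have cd: "continuous_on {-1..1} d" unfolding d_def by (intro continuous_intros cf continuous_on_trig_sum)
    note [continuous_intros] = cd
    have e: "?e k x = Complex (cos (of_int k * ?\<theta> x)) (sin (of_int k * ?\<theta> x))" for k x
      by (simp add: complex_eq_iff Re_exp Im_exp mult_ac)
    have cos_e: "complex_of_real (cos (real k * ?\<theta> x)) = (cnj (?e (int k) x) + cnj (?e (- int k) x)) / 2"
      and sin_e: "complex_of_real (sin (real k * ?\<theta> x)) = (cnj (?e (- int k) x) - cnj (?e (int k) x)) / (2 * \<i>)" for k x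
      unfolding e by (simp_all add: complex_eq_iff)
    have co: "integral {-1..1} (\<lambda>x. d x * complex_of_real (cos (real k * ?\<theta> x))) = 0"
      and si: "integral {-1..1} (\<lambda>x. d x * complex_of_real (sin (real k * ?\<theta> x))) = 0" if k: "k \<le> n" for k
    proof -
      have i: "(\<lambda>x. a * (d x * cnj (?e j x))) integrable_on {-1..1}" for a j
        by (intro integrable_continuous_interval continuous_intros)
      have z: "integral {-1..1} (\<lambda>x. a * (d x * cnj (?e j x))) = 0" if "\<bar>j\<bar> \<le> int n" for a j
        unfolding integral_mult_right using c[OF that] by (simp add: d_def)
      have "integral {-1..1} (\<lambda>x. d x * complex_of_real (cos (real k * ?\<theta> x)))
          = integral {-1..1} (\<lambda>x. 1 / 2 * (d x * cnj (?e (int k) x)) + 1 / 2 * (d x * cnj (?e (- int k) x)))"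
        unfolding cos_e by (rule integral_cong) (simp only: distrib_left add_divide_distrib times_divide_eq_right times_divide_eq_left mult_1)
      also have "\<dots> = 0" using z[of "int k" "1 / 2"] z[of "- int k" "1 / 2"] k by (subst integral_add[OF i i]) simp
      finally show "integral {-1..1} (\<lambda>x. d x * complex_of_real (cos (real k * ?\<theta> x))) = 0" .
      have "integral {-1..1} (\<lambda>x. d x * complex_of_real (sin (real k * ?\<theta> x)))
          = integral {-1..1} (\<lambda>x. 1 / (2 * \<i>) * (d x * cnj (?e (- int k) x)) - 1 / (2 * \<i>) * (d x * cnj (?e (int k) x)))"
        unfolding sin_e by (rule integral_cong) (simp only: right_diff_distrib diff_divide_distrib times_divide_eq_right times_divide_eq_left mult_1)
      also have "\<dots> = 0" using z[of "int k" "1 / (2 * \<i>)"] z[of "- int k" "1 / (2 * \<i>)"] k by (subst integral_diff[OF i i]) simp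
      finally show "integral {-1..1} (\<lambda>x. d x * complex_of_real (sin (real k * ?\<theta> x))) = 0" .
    qed
    have parts: "integral {-1..1} (\<lambda>x. Re (d x) * g x) = 0 \<and> integral {-1..1} (\<lambda>x. Im (d x) * g x) = 0"
      if g: "continuous_on {-1..1} g" and 0: "integral {-1..1} (\<lambda>x. d x * complex_of_real (g x)) = 0" for g
    proof -
      have "(\<lambda>x. d x * complex_of_real (g x)) integrable_on {-1..1}"
        by (intro integrable_continuous_interval continuous_intros g)
      from integral_Re_complex[OF this] show ?thesis unfolding 0 by simp
    qed
    have cc: "continuous_on {-1..1} (\<lambda>x. cos (real k * ?\<theta> x))" "continuous_on {-1..1} (\<lambda>x. sin (real k * ?\<theta> x))" for k
      using T by (auto intro!: continuous_intros)
    have Re_r: "Re (trig_sum T n c x) = (\<Sum>k=-int n..int n. Re (c k) * cos (of_int k * ?\<theta> x) + (- Im (c k)) * sin (of_int k * ?\<theta> x))"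
      and Im_r: "Im (trig_sum T n c x) = (\<Sum>k=-int n..int n. Im (c k) * cos (of_int k * ?\<theta> x) + Re (c k) * sin (of_int k * ?\<theta> x))" for x
      unfolding trig_sum_def e by (simp_all add: algebra_simps)
    have dRe: "Re (f x) - Re (trig_sum T n c x) = Re (d x)"
      and dIm: "Im (f x) - Im (trig_sum T n c x) = Im (d x)" for x
      by (simp_all add: d_def)
    have le: "cmod (f x - trig_sum T n c x) \<le> \<eta> n" if x: "x \<in> {-1..1}" for x
    proof -
      have "\<bar>Re (f x) - Re (trig_sum T n c x)\<bar> \<le> C1 * (rate \<alpha> (2 * n) + rate \<alpha> (2 * n + 1))"
      proof (rule C1[rule_format, OF n _ _ x, of "\<lambda>x. Re (trig_sum T n c x)"])
        show "Re (trig_sum T n c y) = (\<Sum>k=-int n..int n. Re (c k) * cos (of_int k * ?\<theta> y) + (- Im (c k)) * sin (of_int k * ?\<theta> y))" for y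
          by (rule Re_r)
        fix k assume k: "k \<le> n"
        show "integral {-1..1} (\<lambda>x. (Re (f x) - Re (trig_sum T n c x)) * cos (real k * ?\<theta> x)) = 0 \<and>
            integral {-1..1} (\<lambda>x. (Re (f x) - Re (trig_sum T n c x)) * sin (real k * ?\<theta> x)) = 0"
          unfolding dRe using parts[OF cc(1) co[OF k]] parts[OF cc(2) si[OF k]] by (intro conjI) (elim conjE, assumption)+
      qed
      moreover have "\<bar>Im (f x) - Im (trig_sum T n c x)\<bar> \<le> C2 * (rate \<alpha> (2 * n) + rate \<alpha> (2 * n + 1))"
      proof (rule C2[rule_format, OF n _ _ x, of "\<lambda>x. Im (trig_sum T n c x)"])
        show "Im (trig_sum T n c y) = (\<Sum>k=-int n..int n. Im (c k) * cos (of_int k * ?\<theta> y) + Re (c k) * sin (of_int k * ?\<theta> y))" for y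
          by (rule Im_r)
        fix k assume k: "k \<le> n"
        show "integral {-1..1} (\<lambda>x. (Im (f x) - Im (trig_sum T n c x)) * cos (real k * ?\<theta> x)) = 0 \<and>
            integral {-1..1} (\<lambda>x. (Im (f x) - Im (trig_sum T n c x)) * sin (real k * ?\<theta> x)) = 0"
          unfolding dIm using parts[OF cc(1) co[OF k]] parts[OF cc(2) si[OF k]] by (intro conjI) (elim conjE, assumption)+
      qed
      ultimately show ?thesis
        using cmod_le[of "f x - trig_sum T n c x"]
        unfolding \<eta>_def distrib_right minus_complex.sel by linarith
    qed
    have "continuous_on {-1<..<1} (\<lambda>x. f x - trig_sum T n c x)"
      by (intro continuous_intros continuous_on_subset[OF cf] continuous_on_trig_sum) auto
    hence cont: "continuous_on {-1<..<1} (\<lambda>x. f x - fourier_extension T (2 * n + 1) f x)"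
      by (rule continuous_on_eq) (unfold fe, simp)
    have "cmod (f x - fourier_extension T (2 * n + 1) f x) \<le> \<eta> n" if "x \<in> {-1<..<1}" for x
      unfolding fe using le[of x] that by simp
    from Linf_norm_bounds[OF cont this] show ?thesis by (rule conjI)
  qed

  have "(rate \<alpha> \<circ> (\<lambda>n. 2 * n)) \<longlonglongrightarrow> 0" "(rate \<alpha> \<circ> (\<lambda>n. 2 * n + 1)) \<longlonglongrightarrow> 0"
    by (intro LIMSEQ_subseq_LIMSEQ rate_tendsto_0 assms(3); simp add: strict_mono_def)+
  hence "\<eta> \<longlonglongrightarrow> (C1 + C2) * (0 + 0)"
    unfolding \<eta>_def[abs_def] o_def by (intro tendsto_mult tendsto_add tendsto_const)
  hence \<eta>: "(\<lambda>n. ereal (\<eta> n)) \<longlonglongrightarrow> 0" by (simp add: zero_ereal_def)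
  show ?thesis
  proof (rule tendsto_sandwich[OF _ _ tendsto_const \<eta>])
    show "\<forall>\<^sub>F n in sequentially. 0 \<le> Linf_norm (\<lambda>x. f x - fourier_extension T (2 * n + 1) f x)"
      using bounds by (intro eventually_sequentiallyI[of 1]) blast
    show "\<forall>\<^sub>F n in sequentially. Linf_norm (\<lambda>x. f x - fourier_extension T (2 * n + 1) f x) \<le> ereal (\<eta> n)"
      using bounds by (intro eventually_sequentiallyI[of 1]) blast
  qed
qed

end
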